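(* Let $n\geq 3$, $m\geq 0$, $s\in\{m+2,\dots,2m+3\}$ be integers, let $\varphi\colon \mathcal O_{\mathbb P^s}^{\oplus n+m}\to\mathcal O_{\mathbb P^s}(1)^{\oplus n}$ be a general morphism, and let $S$, $\psi\colon S\to\mathbb P^{n-1}$, $Z$ and $P_{[v],[w]}$ be as defined in the context. Let $P=(\rho_1,\rho_2,\rho_3)\in Z$. Then one of the following holds: (a) there exist two (and only two) distinct points $[v],[w]\in S\cap[\rho_2]$ such that $P=P_{[v],[w]}$; (b) $[\rho_2]\subset S$ and $\psi([\rho_2])$ reduces to a point in $[\rho_1]\subset\mathbb P^{n-1}$; (c) there exists exactly one point $[v]\in S$ where $[\rho_2]$ is tangent (to $S$) and such that $[\alpha_v]\in[\rho_1]$; (d) $[\rho_2]\subset S$ and $[\rho_1]=\psi([\rho_2])\subset\mathbb P^{n-1}$.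
   Context: Work over $\mathbb C$. $V_d=\mathbb C^d$, $\mathbb P^s=\mathbb P(V_{s+1})$ is the space of one-dimensional subspaces, and $\mathrm{Gr}(k,d)$ is the Grassmannian of $k$-dimensional subspaces of $V_d$, with tautological rank $k$ subbundle $\mathcal U$. The morphism $\varphi$ is the same as an $n\times(n+m)$ matrix $M$ of linear forms on $V_{s+1}$, with value $M_v\in\mathsf{Mat}_{n,n+m}(\mathbb C)$ at $v\in V_{s+1}$. "General" means for all $M$ in some nonempty Zariski open subset of the space of such matrices. $S=D_{n-1}(\varphi)\subset\mathbb P^s$ is the closed subscheme where $\mathrm{rank}(M_v)\le n-1$ (defined by the maximal minors); in the given range it is smooth of dimension $s-m-1$, and $\mathrm{rank}(M_v)=n-1$ for every $[v]\in S$. For $[v]\in S$, $\alpha_v\in V_n$ is the nonzero vector, unique up to scaling, with $M_v^t\cdot\alpha_v=0$; the map $\psi\colon S\to\mathbb P^{n-1}$ is $[v]\mapsto[\alpha_v]$. For distinct $[v],[w]\in S$ put $\pi_{v,w}=\langle M_v^t\cdot\alpha_w,\ M_w^t\cdot\alpha_v\rangle\subset V_{n+m}$. If $\dim\pi_{v,w}=2$, put $$P_{[v],[w]}=\left(\langle\alpha_v,\alpha_w\rangle,\ \langle v,w\rangle,\ \pi_{v,w}^{\perp}\right)\in \mathrm{Gr}(2,n)\times\mathrm{Gr}(2,s+1)\times\mathrm{Gr}(n+m-2,n+m),$$ where $\perp$ is taken with respect to the standard bilinear form $(x,y)\mapsto x^t y$ on $V_{n+m}$. In (a), the equality $P=P_{[v],[w]}$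 includes that $\dim\pi_{v,w}=2$. The trilinear form $\omega(a,u,b)=a^t\cdot M_u\cdot b$ on $V_n\times V_{s+1}\times V_{n+m}$ defines a section of $\mathcal U^\vee\boxtimes\mathcal U^\vee\boxtimes\mathcal U^\vee$ on $\mathrm{Gr}(2,n)\times\mathrm{Gr}(2,s+1)\times\mathrm{Gr}(n+m-2,n+m)$, and $Z$ is its zero scheme: $(\rho_1,\rho_2,\rho_3)\in Z$ if and only if $\omega(a,u,b)=0$ for all $a\in\rho_1,u\in\rho_2,b\in\rho_3$. For $\rho\in\mathrm{Gr}(2,k)$, $[\rho]\subset\mathbb P^{k-1}$ denotes the corresponding projective line. *)

theory Defs
  imports "HOL-Analysis.Analysis"
begin

text \<open>Complex linear algebra is done with the library's interpretation \<open>vec\<close> of vector spaces on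
  \<^typ>\<open>complex^'k\<close>; the unprefixed \<open>span\<close>, \<open>dim\<close>, \<open>subspace\<close> would be the real notions.
  Throughout, \<open>V_n\<close>, \<open>V_{s+1}\<close>, \<open>V_{n+m}\<close> are \<^typ>\<open>complex^'n\<close>, \<^typ>\<open>complex^'r\<close>, \<^typ>\<open>complex^'p\<close>.\<close>

definition Gr :: "nat \<Rightarrow> (complex^'k::finite) set set" where
  "Gr k = {\<rho>. vec.subspace \<rho> \<and> vec.dim \<rho> = k}"

abbreviation proj_space :: "(complex^'k::finite) set set" where
  "proj_space \<equiv> Gr 1"

text \<open>The point \<open>[v]\<close> of projective space, for \<open>v \<noteq> 0\<close> (for \<open>v = 0\<close> this is not a point).\<close>
definition pt :: "complex^'k::finite \<Rightarrow> (complex^'k) set" where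
  "pt v = vec.span {v}"

text \<open>The projective linear space \<open>[\<rho>]\<close>, as a set of points.\<close>
definition proj_sub :: "(complex^'k::finite) set \<Rightarrow> (complex^'k) set set" where
  "proj_sub \<rho> = {L \<in> proj_space. L \<subseteq> \<rho>}"

text \<open>The standard bilinear form; the library's inner product on \<^typ>\<open>complex^'k\<close> is real-valued.\<close>
definition bil :: "complex^'k::finite \<Rightarrow> complex^'k \<Rightarrow> complex" where
  "bil x y = (\<Sum>i\<in>UNIV. x $ i * y $ i)"

definition perp :: "(complex^'k::finite) set \<Rightarrow> (complex^'k) set" where
  "perp W = {y. \<forall>x\<in>W. bil x y = 0}"

text \<open>A matrix of linear forms: \<open>M $ i $ j\<close> is the coefficient vector of the \<open>(i,j)\<close> entry.
  \<open>ev M v\<close> is \<open>M_v\<close>.\<close>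
type_synonym ('r, 'p, 'n) linmat = "complex^'r^'p^'n"

definition ev :: "('r::finite, 'p::finite, 'n::finite) linmat \<Rightarrow> complex^'r \<Rightarrow> complex^'p^'n" where
  "ev M v = (\<chi> i j. \<Sum>u\<in>UNIV. M $ i $ j $ u * v $ u)"

inductive poly_fun :: "(('r::finite, 'p::finite, 'n::finite) linmat \<Rightarrow> complex) \<Rightarrow> bool" where
  const: "poly_fun (\<lambda>M. c)"
| coord: "poly_fun (\<lambda>M. M $ i $ j $ u)"
| add: "poly_fun f \<Longrightarrow> poly_fun g \<Longrightarrow> poly_fun (\<lambda>M. f M + g M)"
| mult: "poly_fun f \<Longrightarrow> poly_fun g \<Longrightarrow> poly_fun (\<lambda>M. f M * g M)"

definition zariski_open :: "('r::finite, 'p::finite, 'n::finite) linmat set \<Rightarrow> bool" where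
  "zariski_open U \<longleftrightarrow> (\<exists>F. (\<forall>f\<in>F. poly_fun f) \<and> U = {M. \<exists>f\<in>F. f M \<noteq> 0})"

text \<open>The points of the degeneracy scheme \<open>S\<close>; its scheme structure enters through
  \<open>tangent_space\<close> below.\<close>
definition S :: "('r::finite, 'p::finite, 'n::finite) linmat \<Rightarrow> (complex^'r) set set" where
  "S M = {L \<in> proj_space. \<forall>v\<in>L. rank (ev M v) \<le> CARD('n) - 1}"

text \<open>\<open>alpha M [v]\<close> is \<open>\<alpha>_v\<close>. It is meaningful when the kernel of \<open>M_v\<^sup>t\<close> is a line, and is then
  chosen once for each point \<open>[v]\<close>; nothing below depends on the choice.\<close>
definition alpha :: "('r::finite, 'p::finite, 'n::finite) linmat \<Rightarrow> (complex^'r) set \<Rightarrow> complex^'n" where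
  "alpha M L = (SOME a. a \<noteq> 0 \<and> (\<forall>v\<in>L. transpose (ev M v) *v a = 0))"

definition psi :: "('r::finite, 'p::finite, 'n::finite) linmat \<Rightarrow> (complex^'r) set \<Rightarrow> (complex^'n) set" where
  "psi M L = pt (alpha M L)"

definition pi_sp :: "('r::finite, 'p::finite, 'n::finite) linmat \<Rightarrow> complex^'r \<Rightarrow> complex^'r \<Rightarrow> (complex^'p) set" where
  "pi_sp M v w = vec.span {transpose (ev M v) *v alpha M (pt w), transpose (ev M w) *v alpha M (pt v)}"

text \<open>The triple \<open>P_{[v],[w]}\<close>, to be used only when \<open>vec.dim (pi_sp M v w) = 2\<close>.\<close>
definition P_pt :: "('r::finite, 'p::finite, 'n::finite) linmat \<Rightarrow> complex^'r \<Rightarrow> complex^'r \<Rightarrow>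
    (complex^'n) set \<times> (complex^'r) set \<times> (complex^'p) set" where
  "P_pt M v w = (vec.span {alpha M (pt v), alpha M (pt w)}, vec.span {v, w}, perp (pi_sp M v w))"

definition omega :: "('r::finite, 'p::finite, 'n::finite) linmat \<Rightarrow> complex^'n \<Rightarrow> complex^'r \<Rightarrow> complex^'p \<Rightarrow> complex" where
  "omega M a u b = bil a (ev M u *v b)"

definition Z :: "('r::finite, 'p::finite, 'n::finite) linmat \<Rightarrow>
    ((complex^'n) set \<times> (complex^'r) set \<times> (complex^'p) set) set" where
  "Z M = {(\<rho>1, \<rho>2, \<rho>3). \<rho>1 \<in> Gr 2 \<and> \<rho>2 \<in> Gr 2 \<and> \<rho>3 \<in> Gr (CARD('p) - 2) \<and>
     (\<forall>a\<in>\<rho>1. \<forall>u\<in>\<rho>2. \<forall>b\<in>\<rho>3. omega M a u b = 0)}"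

text \<open>The maximal minor of \<open>M_v\<close> on the columns \<open>c\<close>. Running over all injective \<open>c\<close> only repeats
  each minor up to sign.\<close>
definition max_minor :: "('r::finite, 'p::finite, 'n::finite) linmat \<Rightarrow> ('n \<Rightarrow> 'p) \<Rightarrow> complex^'r \<Rightarrow> complex" where
  "max_minor M c v = det (\<chi> i j. ev M v $ i $ c j)"

text \<open>The linear subspace of \<open>V_{s+1}\<close> whose projectivization is the embedded tangent space of the
  scheme \<open>S\<close> at the point \<open>L = [v]\<close>: the common kernel of the differentials at \<open>v\<close> of the
  maximal minors.\<close>
definition tangent_space :: "('r::finite, 'p::finite, 'n::finite) linmat \<Rightarrow> (complex^'r) set \<Rightarrow> (complex^'r) set" where
  "tangent_space M L = {w. \<forall>v\<in>L - {0}. \<forall>c. inj c \<longrightarrow>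
     ((\<lambda>t::complex. max_minor M c (v + t *s w)) has_field_derivative 0) (at 0)}"

text \<open>The line \<open>[\<rho>]\<close> passes through the point \<open>L\<close> of \<open>S\<close> and is tangent to \<open>S\<close> there; this
  includes the case that \<open>[\<rho>]\<close> lies in \<open>S\<close>.\<close>
definition tangent_at :: "('r::finite, 'p::finite, 'n::finite) linmat \<Rightarrow> (complex^'r) set \<Rightarrow> (complex^'r) set \<Rightarrow> bool" where
  "tangent_at M \<rho> L \<longleftrightarrow> L \<in> S M \<and> L \<in> proj_sub \<rho> \<and> \<rho> \<subseteq> tangent_space M L"

end

theory Submission
  imports Defs "HOL-Computational_Algebra.Polynomial"
begin

text \<open>A point \<open>(\<rho>\<^sub>1, \<rho>\<^sub>2, \<rho>\<^sub>3)\<close> of \<open>Z\<close> is a bilinear map \<open>(a, u) \<mapsto> M\<^sub>u\<^sup>t a\<close> from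
  \<open>\<rho>\<^sub>1 \<times> \<rho>\<^sub>2\<close> to the plane \<open>\<rho>\<^sub>3\<^sup>\<bottom>\<close>, that is, a \<open>2 \<times> 2 \<times> 2\<close> tensor. The classification follows from
  one property of a general \<open>M\<close>: the left kernel of \<open>M\<^sub>v\<close> is at most a line for every \<open>v \<noteq> 0\<close>.

  Choosing bases of \<open>\<rho>\<^sub>1\<close> and \<open>\<rho>\<^sub>3\<^sup>\<bottom>\<close>, the map \<open>a \<mapsto> M\<^sub>u\<^sup>t a\<close> is a \<open>2 \<times> 2\<close> matrix whose determinant is
  a binary quadratic form in \<open>u \<in> \<rho>\<^sub>2\<close>. The zeros of this form are the points \<open>[u]\<close> of \<open>S \<inter> [\<rho>\<^sub>2]\<close> with
  \<open>[\<alpha>\<^sub>u] \<in> [\<rho>\<^sub>1]\<close>; they are called incident below. Over the complex numbers there is at least one.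
  If the form vanishes identically, then \<open>[\<rho>\<^sub>2] \<subseteq> S\<close>, and \<open>\<psi>\<close> restricted to \<open>[\<rho>\<^sub>2]\<close> is constant or an
  isomorphism onto \<open>[\<rho>\<^sub>1]\<close>, cases (b) and (d). If it has two distinct zeros \<open>[v]\<close> and \<open>[w]\<close>, then
  \<open>M\<^sub>v\<^sup>t \<alpha>\<^sub>w\<close> and \<open>M\<^sub>w\<^sup>t \<alpha>\<^sub>v\<close> are independent, so they span \<open>\<rho>\<^sub>3\<^sup>\<bottom>\<close>, which is case (a). If it has one
  double zero \<open>[v]\<close>, then \<open>M\<^sub>w\<^sup>t \<alpha>\<^sub>v\<close> lies in the image of \<open>M\<^sub>v\<^sup>t\<close> for all \<open>w \<in> \<rho>\<^sub>2\<close>, and this makes the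
  maximal minors vanish to second order at \<open>v\<close> along \<open>\<rho>\<^sub>2\<close>, which is case (c).

  That a general \<open>M\<close> has left kernels of dimension at most one is a dimension count. The matrices
  having a left kernel of dimension two or more at some \<open>[v]\<close> are covered by the images of finitely many
  polynomial maps, each in at most \<open>N + s - (2m + 4) < N\<close> parameters, where \<open>N\<close> is the number of
  coefficients of \<open>M\<close>. Such images lie in a hypersurface
  (\<open>parametrized_images_in_hypersurface\<close>): the polynomials with all exponents at most \<open>d\<close> form a space
  of dimension \<open>(d + 1)\<^sup>N\<close>, while their pullbacks lie in a space whose dimension grows only like
  \<open>d\<^sup>N\<^sup>-\<^sup>1\<close>. Hence some nonzero polynomial pulls back to zero along all the maps.\<close>

section \<open>Images of polynomial maps in too few variables\<close>

text \<open>Gaussian elimination: solve one equation for one unknown and substitute into the others. The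
  unknowns are indexed by a set, since they will be exponent vectors.\<close>
lemma homogeneous_system_nontrivial_solution:
  fixes A :: "'r \<Rightarrow> 'e \<Rightarrow> 'k::field"
  assumes "finite R" "finite E" "card R < card E"
  shows "\<exists>c. (\<exists>e\<in>E. c e \<noteq> 0) \<and> (\<forall>r\<in>R. (\<Sum>e\<in>E. A r e * c e) = 0)"
  using assms
proof (induction R arbitrary: E A rule: finite_induct)
  case empty
  then have "E \<noteq> {}" by auto
  then show ?case by (intro exI[of _ "\<lambda>_. 1"]) auto
next
  case (insert r R)
  show ?case
  proof (cases "\<forall>e\<in>E. A r e = 0")
    case True
    obtain c where "\<exists>e\<in>E. c e \<noteq> 0" "\<forall>q\<in>R. (\<Sum>e\<in>E. A q e * c e) = 0"
      using insert.IH[of E A] insert.prems insert.hyps by auto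
    with True show ?thesis by (intro exI[of _ c]) auto
  next
    case False
    then obtain p where p: "p \<in> E" "A r p \<noteq> 0" by auto
    define E' where "E' = E - {p}"
    have E': "finite E'" "E = insert p E'" "p \<notin> E'"
      using p insert.prems by (auto simp: E'_def)
    have "card R < card E'"
      using insert.prems insert.hyps E' by auto
    from insert.IH[OF E'(1) this, of "\<lambda>q e. A q e - A q p / A r p * A r e"]
    obtain c where c: "\<exists>e\<in>E'. c e \<noteq> 0"
      "\<And>q. q \<in> R \<Longrightarrow> (\<Sum>e\<in>E'. (A q e - A q p / A r p * A r e) * c e) = 0"
      by auto
    define cp where "cp = - (\<Sum>e\<in>E'. A r e * c e) / A r p"
    have sum_E: "(\<Sum>e\<in>E. A q e * (c(p := cp)) e) = A q p * cp + (\<Sum>e\<in>E'. A q e * c e)" for q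
    proof -
      have "(\<Sum>e\<in>E'. A q e * (c(p := cp)) e) = (\<Sum>e\<in>E'. A q e * c e)"
        using E' by (intro sum.cong) auto
      then show ?thesis unfolding E'(2) using E' by simp
    qed
    have "(\<Sum>e\<in>E. A q e * (c(p := cp)) e) = 0" if "q \<in> insert r R" for q
    proof (cases "q = r")
      case True
      then show ?thesis unfolding sum_E using p by (simp add: cp_def)
    next
      case False
      then have "(\<Sum>e\<in>E'. A q e * c e) = A q p / A r p * (\<Sum>e\<in>E'. A r e * c e)"
        using c(2)[of q] that
        by (simp add: algebra_simps sum_subtractf sum_distrib_left)
      then show ?thesis unfolding sum_E by (simp add: cp_def)
    qed
    moreover have "\<exists>e\<in>E. (c(p := cp)) e \<noteq> 0"
      using c(1) E' by auto
    ultimately show ?thesis by blast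
  qed
qed

text \<open>A polynomial with a nonzero coefficient is a nonzero function over an infinite field. The
  induction views it as a polynomial in the new variable whose coefficients are polynomials in the
  old ones, and picks values of the old variables at which one of these is not zero.\<close>
lemma nonzero_coefficients_nonvanishing:
  fixes c :: "('j \<Rightarrow> nat) \<Rightarrow> 'k::field_char_0"
  assumes "finite J" "e0 \<in> PiE J (\<lambda>_. {..d})" "c e0 \<noteq> 0"
  shows "\<exists>y. (\<Sum>e\<in>PiE J (\<lambda>_. {..d}). c e * (\<Prod>j\<in>J. y j ^ e j)) \<noteq> 0"
  using assms
proof (induction J arbitrary: c e0 rule: finite_induct)
  case empty
  then show ?case by simp
next
  case (insert j J)
  let ?P = "PiE J (\<lambda>_. {..d})"
  from insert.prems(1) obtain k e1 where e1: "k \<le> d" "e1 \<in> ?P" "e0 = e1(j := k)"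
    unfolding PiE_insert_eq by auto
  have "c (e1(j := k)) \<noteq> 0" using insert.prems(2) unfolding e1(3) .
  from insert.IH[OF e1(2), of "\<lambda>e. c (e(j := k))", OF this]
  obtain y where y: "(\<Sum>e\<in>?P. c (e(j := k)) * (\<Prod>j\<in>J. y j ^ e j)) \<noteq> 0"
    by auto
  define a where "a i = (\<Sum>e\<in>?P. c (e(j := i)) * (\<Prod>j\<in>J. y j ^ e j))" for i
  have "coeff (\<Sum>i\<le>d. monom (a i) i) k \<noteq> 0"
    using e1(1) y by (simp add: coeff_sum a_def)
  then have "(\<Sum>i\<le>d. monom (a i) i) \<noteq> 0" by auto
  then obtain t where t: "poly (\<Sum>i\<le>d. monom (a i) i) t \<noteq> 0"
    using poly_all_0_iff_0 by blast
  have inj: "inj_on (\<lambda>(i, e). e(j := i)) ({..d} \<times> ?P)"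
    using insert.hyps by (intro inj_combinator)
  have "(\<Sum>e\<in>PiE (insert j J) (\<lambda>_. {..d}). c e * (\<Prod>i\<in>insert j J. (y(j := t)) i ^ e i))
      = (\<Sum>(i, e)\<in>{..d} \<times> ?P. c (e(j := i)) * (\<Prod>l\<in>insert j J. (y(j := t)) l ^ (e(j := i)) l))"
    unfolding PiE_insert_eq by (subst sum.reindex[OF inj]) (auto intro!: sum.cong)
  also have "\<dots> = (\<Sum>(i, e)\<in>{..d} \<times> ?P. c (e(j := i)) * (t ^ i * (\<Prod>l\<in>J. y l ^ e l)))"
  proof (intro sum.cong refl, clarify)
    fix i e
    have "(\<Prod>l\<in>J. (y(j := t)) l ^ (e(j := i)) l) = (\<Prod>l\<in>J. y l ^ e l)"
      using insert.hyps by (intro prod.cong) auto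
    then show "c (e(j := i)) * (\<Prod>l\<in>insert j J. (y(j := t)) l ^ (e(j := i)) l)
        = c (e(j := i)) * (t ^ i * (\<Prod>l\<in>J. y l ^ e l))"
      using insert.hyps by simp
  qed
  also have "\<dots> = poly (\<Sum>i\<le>d. monom (a i) i) t"
    by (simp add: sum.cartesian_product[symmetric] poly_sum poly_monom a_def sum_distrib_left
        sum_distrib_right mult_ac)
  finally show ?case using t by metis
qed

text \<open>The functions given by a polynomial in the variables \<open>x i\<close>, \<open>i \<in> I\<close>, of degree at most \<open>D\<close> in each
  variable separately. With this bound the monomials are the finite set \<open>PiE I (\<lambda>_. {..D})\<close>,
  which is easy to count.\<close>
definition poly_in :: "'a set \<Rightarrow> nat \<Rightarrow> (('a \<Rightarrow> 'k::comm_ring_1) \<Rightarrow> 'k) \<Rightarrow> bool" where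
  "poly_in I D f \<longleftrightarrow>
    (\<exists>c. \<forall>x. f x = (\<Sum>e\<in>PiE I (\<lambda>_. {..D}). c e * (\<Prod>i\<in>I. x i ^ e i)))"

lemma poly_in_monomial:
  assumes "finite I" "\<And>i. i \<in> I \<Longrightarrow> e i \<le> D"
  shows "poly_in I D (\<lambda>x. k * (\<Prod>i\<in>I. x i ^ e i))"
  unfolding poly_in_def
proof (intro exI allI)
  fix x :: "'a \<Rightarrow> 'b"
  let ?e = "restrict e I"
  have "?e \<in> PiE I (\<lambda>_. {..D})" using assms by auto
  moreover have "finite (PiE I (\<lambda>_. {..D}))" using assms by (intro finite_PiE) auto
  ultimately have "(\<Sum>e'\<in>PiE I (\<lambda>_. {..D}). (if e' = ?e then k else 0) * (\<Prod>i\<in>I. x i ^ e' i))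
      = k * (\<Prod>i\<in>I. x i ^ ?e i)"
    by (simp add: if_distrib[where f="\<lambda>z. z * _"] cong: if_cong)
  then show "k * (\<Prod>i\<in>I. x i ^ e i) =
     (\<Sum>e'\<in>PiE I (\<lambda>_. {..D}). (if e' = ?e then k else 0) * (\<Prod>i\<in>I. x i ^ e' i))"
    by simp
qed

lemma poly_in_const: "finite I \<Longrightarrow> poly_in I D (\<lambda>x. k)"
  using poly_in_monomial[of I "\<lambda>_. 0" D k] by simp

lemma poly_in_var:
  assumes "finite I" "i \<in> I" "1 \<le> D"
  shows "poly_in I D (\<lambda>x. x i)"
proof -
  have "(\<Prod>l\<in>I. x l ^ (if l = i then 1 else 0)) = x i" for x :: "'a \<Rightarrow> 'b"
    using assms by (simp add: if_distrib[where f="\<lambda>z. _ ^ z"] cong: if_cong)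
  then show ?thesis
    using poly_in_monomial[of I "\<lambda>l. if l = i then 1 else 0" D "1 :: 'b"] assms by (simp del: One_nat_def)
qed

lemma poly_in_add:
  assumes "poly_in I D f" "poly_in I D g"
  shows "poly_in I D (\<lambda>x. f x + g x)"
proof -
  from assms obtain c c' where
    "\<And>x. f x = (\<Sum>e\<in>PiE I (\<lambda>_. {..D}). c e * (\<Prod>i\<in>I. x i ^ e i))"
    "\<And>x. g x = (\<Sum>e\<in>PiE I (\<lambda>_. {..D}). c' e * (\<Prod>i\<in>I. x i ^ e i))"
    unfolding poly_in_def by blast
  then show ?thesis unfolding poly_in_def
    by (intro exI[of _ "\<lambda>e. c e + c' e"]) (simp add: distrib_right sum.distrib)
qed

lemma poly_in_sum:
  assumes "finite I" "\<And>q. q \<in> Q \<Longrightarrow> poly_in I D (f q)"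
  shows "poly_in I D (\<lambda>x. \<Sum>q\<in>Q. f q x)"
  using assms(2)
  by (induction Q rule: infinite_finite_induct) (auto intro: poly_in_add poly_in_const assms(1))

lemma poly_in_mult:
  assumes fin: "finite I" and "poly_in I D f" "poly_in I D' g"
  shows "poly_in I (D + D') (\<lambda>x. f x * g x)"
proof -
  from assms obtain c c' where
    c: "\<And>x. f x = (\<Sum>e\<in>PiE I (\<lambda>_. {..D}). c e * (\<Prod>i\<in>I. x i ^ e i))"
    "\<And>x. g x = (\<Sum>e\<in>PiE I (\<lambda>_. {..D'}). c' e * (\<Prod>i\<in>I. x i ^ e i))"
    unfolding poly_in_def by blast
  have "f x * g x = (\<Sum>e\<in>PiE I (\<lambda>_. {..D}). \<Sum>e'\<in>PiE I (\<lambda>_. {..D'}).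
      (c e * c' e') * (\<Prod>i\<in>I. x i ^ (e i + e' i)))" for x
    unfolding c sum_product by (intro sum.cong refl) (simp add: power_add prod.distrib mult_ac)
  moreover have "poly_in I (D + D') (\<lambda>x. \<Sum>e\<in>PiE I (\<lambda>_. {..D}). \<Sum>e'\<in>PiE I (\<lambda>_. {..D'}).
      (c e * c' e') * (\<Prod>i\<in>I. x i ^ (e i + e' i)))"
    by (intro poly_in_sum poly_in_monomial fin) (auto intro!: add_mono)
  ultimately show ?thesis by presburger
qed

lemma poly_in_power:
  assumes "finite I" "poly_in I D f"
  shows "poly_in I (n * D) (\<lambda>x. f x ^ n)"
  by (induction n) (auto intro: assms poly_in_const poly_in_mult)

lemma poly_in_prod:
  assumes "finite I" "\<And>q. q \<in> Q \<Longrightarrow> poly_in I (D q) (f q)"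
  shows "poly_in I (\<Sum>q\<in>Q. D q) (\<lambda>x. \<Prod>q\<in>Q. f q x)"
  using assms(2)
  by (induction Q rule: infinite_finite_induct) (auto intro: poly_in_mult poly_in_const assms(1))

lemma poly_in_mono:
  assumes "finite I" "poly_in I D f" "D \<le> D'"
  shows "poly_in I D' f"
  using poly_in_mult[OF assms(1,2) poly_in_const[OF assms(1)], of "D' - D" 1] assms(3) by simp

text \<open>The polynomial \<open>\<Sum>e. c e * y\<^sup>e\<close> is to vanish on the images of all the maps \<open>\<phi> t\<close>. This is a homogeneous
  linear system for \<open>c\<close> with one equation for each \<open>t\<close> and each monomial of the pullbacks. As \<open>d\<close> grows
  there are more exponents \<open>e\<close> than equations, because each \<open>\<phi> t\<close> has fewer variables than
  there are coordinates. Treating all \<open>t\<close> in one system avoids multiplying the equations of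
  several hypersurfaces.\<close>
lemma parametrized_images_in_hypersurface:
  fixes \<phi> :: "'t \<Rightarrow> 'j \<Rightarrow> ('i \<Rightarrow> 'k::field_char_0) \<Rightarrow> 'k"
  assumes "finite J" "finite T"
    and I: "\<And>t. t \<in> T \<Longrightarrow> finite (I t)" "\<And>t. t \<in> T \<Longrightarrow> card (I t) < card J"
    and poly: "\<And>t j. t \<in> T \<Longrightarrow> j \<in> J \<Longrightarrow> poly_in (I t) D (\<phi> t j)"
  shows "\<exists>d c. (\<exists>y. (\<Sum>e\<in>PiE J (\<lambda>_. {..d}). c e * (\<Prod>j\<in>J. y j ^ e j)) \<noteq> 0) \<and>
    (\<forall>t\<in>T. \<forall>x. (\<Sum>e\<in>PiE J (\<lambda>_. {..d}). c e * (\<Prod>j\<in>J. \<phi> t j x ^ e j)) = 0)"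
proof (cases "T = {}")
  case True
  then show ?thesis
    by (intro exI[of _ 0] exI[of _ "\<lambda>_. 1"]) (simp add: PiE_singleton)
next
  case False
  define N where "N = card J"
  have "N > 0" using False I(2) unfolding N_def by fastforce
  define a where "a = N * D + 1"
  \<comment> \<open>The number of equations is at most \<open>card T * a ^ (N - 1) * (d + 1) ^ (N - 1)\<close>; taking the
    constant factor for \<open>d\<close> keeps it below the number \<open>(d + 1) ^ N\<close> of unknowns.\<close>
  define d where "d = card T * a ^ (N - 1)"
  let ?E = "PiE J (\<lambda>_. {..d})"
  let ?R = "\<lambda>t. PiE (I t) (\<lambda>_. {..N * (d * D)})"
  have finR: "finite (?R t)" if "t \<in> T" for t
    using I(1)[OF that] by (intro finite_PiE) auto
  have fin_E: "finite ?E" using assms(1) by (intro finite_PiE) auto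
  have "card (?R t) \<le> (a * (d + 1)) ^ (N - 1)" if "t \<in> T" for t
  proof -
    have "card (?R t) = (N * (d * D) + 1) ^ card (I t)"
      using I(1)[OF that] by (simp add: card_PiE)
    also have "\<dots> \<le> (a * (d + 1)) ^ card (I t)"
      by (intro power_mono) (auto simp: a_def algebra_simps)
    also have "\<dots> \<le> (a * (d + 1)) ^ (N - 1)"
      using I(2)[OF that] by (intro power_increasing) (auto simp: N_def a_def)
    finally show ?thesis .
  qed
  then have "card (Sigma T ?R) \<le> (\<Sum>t\<in>T. (a * (d + 1)) ^ (N - 1))"
    using assms(2) finR by (subst card_SigmaI) (auto simp del: sum_constant intro!: sum_mono)
  also have "\<dots> = d * (d + 1) ^ (N - 1)"
    by (simp only: sum_constant power_mult_distrib) (simp add: d_def)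
  also have "\<dots> < (d + 1) * (d + 1) ^ (N - 1)"
    by simp
  also have "\<dots> = card ?E"
    using \<open>N > 0\<close> assms(1) by (cases N) (simp_all add: card_PiE flip: N_def)
  finally have card: "card (Sigma T ?R) < card ?E" .
  have "\<exists>A. \<forall>x. (\<Prod>j\<in>J. \<phi> t j x ^ e j) = (\<Sum>r\<in>?R t. A r * (\<Prod>i\<in>I t. x i ^ r i))"
    if "t \<in> T" "e \<in> ?E" for t e
  proof -
    have "(\<Sum>j\<in>J. e j * D) \<le> (\<Sum>j\<in>J. d * D)"
      using that by (intro sum_mono mult_right_mono) (auto simp: PiE_iff)
    also have "\<dots> = N * (d * D)" by (simp add: N_def)
    finally have "poly_in (I t) (N * (d * D)) (\<lambda>x. \<Prod>j\<in>J. \<phi> t j x ^ e j)"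
      by (intro poly_in_mono[OF I(1) poly_in_prod[OF I(1) poly_in_power[OF I(1) poly]]] that)
    then show ?thesis unfolding poly_in_def .
  qed
  then have "\<forall>t\<in>T. \<forall>e\<in>?E. \<exists>A. \<forall>x.
      (\<Prod>j\<in>J. \<phi> t j x ^ e j) = (\<Sum>r\<in>?R t. A r * (\<Prod>i\<in>I t. x i ^ r i))"
    by (intro ballI)
  then obtain A where A: "\<And>t e x. t \<in> T \<Longrightarrow> e \<in> ?E \<Longrightarrow>
      (\<Prod>j\<in>J. \<phi> t j x ^ e j) = (\<Sum>r\<in>?R t. A t e r * (\<Prod>i\<in>I t. x i ^ r i))"
    unfolding bchoice_iff by fast
  have "finite (Sigma T ?R)" using assms(2) finR by auto
  from homogeneous_system_nontrivial_solution[OF this fin_E card, of "\<lambda>(t, r) e. A t e r"]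
  obtain c where c: "\<exists>e\<in>?E. c e \<noteq> 0"
    "\<forall>q\<in>Sigma T ?R. (\<Sum>e\<in>?E. (case q of (t, r) \<Rightarrow> \<lambda>e. A t e r) e * c e) = 0"
    by (elim exE conjE)
  have c_zero: "(\<Sum>e\<in>?E. A t e r * c e) = 0" if "t \<in> T" "r \<in> ?R t" for t r
  proof -
    have "(t, r) \<in> Sigma T ?R" using that by simp
    from bspec[OF c(2) this] show ?thesis by simp
  qed
  have "(\<Sum>e\<in>?E. c e * (\<Prod>j\<in>J. \<phi> t j x ^ e j)) = 0" if "t \<in> T" for t x
  proof -
    have "(\<Sum>e\<in>?E. c e * (\<Prod>j\<in>J. \<phi> t j x ^ e j))
        = (\<Sum>e\<in>?E. \<Sum>r\<in>?R t. (A t e r * c e) * (\<Prod>i\<in>I t. x i ^ r i))"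
      using A[OF that] by (intro sum.cong refl) (simp add: sum_distrib_left mult_ac)
    also have "\<dots> = (\<Sum>r\<in>?R t. (\<Sum>e\<in>?E. A t e r * c e) * (\<Prod>i\<in>I t. x i ^ r i))"
      by (subst sum.swap) (simp add: sum_distrib_right)
    also have "\<dots> = 0" using c_zero[OF that] by simp
    finally show ?thesis .
  qed
  moreover obtain y where "(\<Sum>e\<in>?E. c e * (\<Prod>j\<in>J. y j ^ e j)) \<noteq> 0"
    using c(1) nonzero_coefficients_nonvanishing[OF assms(1)] by blast
  ultimately show ?thesis by blast
qed

section \<open>Left kernels of a general matrix of linear forms\<close>

text \<open>The vector that represents the linear form \<open>\<omega>(a, u, _)\<close> under the standard bilinear form.\<close>
definition beta :: "('r::finite, 'p::finite, 'n::finite) linmat \<Rightarrow> complex^'n \<Rightarrow> complex^'r \<Rightarrow> complex^'p" where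
  "beta M a u = transpose (ev M u) *v a"

lemma beta_nth: "beta M a u $ j = (\<Sum>i\<in>UNIV. \<Sum>k\<in>UNIV. a $ i * M $ i $ j $ k * u $ k)"
  by (simp add: beta_def ev_def matrix_vector_mult_def transpose_def sum_distrib_left mult_ac)

lemma beta_add: "beta M (a + a') u = beta M a u + beta M a' u"
  and beta_add_right: "beta M a (u + u') = beta M a u + beta M a u'"
  and beta_diff: "beta M (a - a') u = beta M a u - beta M a' u"
  and beta_diff_right: "beta M a (u - u') = beta M a u - beta M a u'"
  and beta_scale: "beta M (c *s a) u = c *s beta M a u"
  and beta_scale_right: "beta M a (c *s u) = c *s beta M a u"
  and beta_zero [simp]: "beta M 0 u = 0"
  and beta_zero_right [simp]: "beta M a 0 = 0"
  by (simp_all add: vec_eq_iff beta_nth algebra_simps sum.distrib sum_subtractf sum_distrib_left)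

lemmas beta_simps = beta_add beta_add_right beta_diff beta_diff_right beta_scale beta_scale_right

definition corank_at_most_one :: "('r::finite, 'p::finite, 'n::finite) linmat \<Rightarrow> bool" where
  "corank_at_most_one M \<longleftrightarrow>
    (\<forall>v a b. v \<noteq> 0 \<longrightarrow> a \<noteq> 0 \<longrightarrow> beta M a v = 0 \<longrightarrow> beta M b v = 0 \<longrightarrow> (\<exists>c. b = c *s a))"

lemma poly_fun_sum:
  "(\<And>q. q \<in> Q \<Longrightarrow> poly_fun (f q)) \<Longrightarrow> poly_fun (\<lambda>M. \<Sum>q\<in>Q. f q M)"
  by (induction Q rule: infinite_finite_induct) (auto intro: poly_fun.intros)

lemma poly_fun_prod:
  "(\<And>q. q \<in> Q \<Longrightarrow> poly_fun (f q)) \<Longrightarrow> poly_fun (\<lambda>M. \<Prod>q\<in>Q. f q M)"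
  by (induction Q rule: infinite_finite_induct) (auto intro: poly_fun.intros)

lemma poly_fun_power: "poly_fun f \<Longrightarrow> poly_fun (\<lambda>M. f M ^ k)"
  by (induction k) (auto intro: poly_fun.intros)

text \<open>A matrix with a left kernel of dimension two or more over some \<open>[v]\<close> lies in one of finitely many charts:
  scale a coordinate of \<open>v\<close> to \<open>1\<close>, and bring a basis of a plane in the kernel to reduced form, with
  an identity block in two of its coordinates.\<close>
lemma not_corank_at_most_one_chart:
  fixes M :: "('r::finite, 'p::finite, 'n::finite) linmat"
  assumes "\<not> corank_at_most_one M"
  obtains v a b u0 k l where "v $ u0 = 1" "k \<noteq> l"
    "a $ k = 1" "a $ l = 0" "b $ k = 0" "b $ l = 1" "beta M a v = 0" "beta M b v = 0"
proof -
  obtain v a b where v: "v \<noteq> 0" and a: "a \<noteq> 0" "beta M a v = 0"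
    and b: "beta M b v = 0" "\<And>c. b \<noteq> c *s a"
    using assms unfolding corank_at_most_one_def by blast
  obtain u0 where u0: "v $ u0 \<noteq> 0" using v by (auto simp: vec_eq_iff)
  obtain k where k: "a $ k \<noteq> 0" using a by (auto simp: vec_eq_iff)
  define v' where "v' = inverse (v $ u0) *s v"
  define a1 where "a1 = inverse (a $ k) *s a"
  define b1 where "b1 = b - (b $ k / a $ k) *s a"
  have "b1 \<noteq> 0" using b(2) by (auto simp: b1_def)
  then obtain l where l: "b1 $ l \<noteq> 0" by (auto simp: vec_eq_iff)
  have b1k: "b1 $ k = 0" using k by (simp add: b1_def)
  define b' where "b' = inverse (b1 $ l) *s b1"
  define a' where "a' = a1 - (a1 $ l) *s b'"
  show ?thesis
  proof (rule that[of v' u0 k l a' b'])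
    show "v' $ u0 = 1" using u0 by (simp add: v'_def)
    show "k \<noteq> l" using l b1k by auto
    show bk: "b' $ k = 0" using b1k by (simp add: b'_def)
    show "b' $ l = 1" using l by (simp add: b'_def)
    then show "a' $ l = 0" by (simp add: a'_def)
    show "a' $ k = 1" using k bk by (simp add: a'_def a1_def)
    show "beta M a' v' = 0" "beta M b' v' = 0"
      using a b by (simp_all add: a'_def b'_def a1_def b1_def v'_def beta_simps)
  qed
qed

text \<open>In the chart \<open>(u0, k, l)\<close> the parameters are the coefficients of \<open>M\<close> (first summand), the coordinates
  of \<open>v\<close> other than \<open>u0\<close>, and the coordinates other than \<open>k\<close> and \<open>l\<close> of the two kernel vectors. The kernel
  vector marked \<open>True\<close> has entry \<open>1\<close> at \<open>k\<close>, the one marked \<open>False\<close> has entry \<open>1\<close> at \<open>l\<close>.\<close>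
type_synonym ('r, 'p, 'n) par = "('n \<times> 'p \<times> 'r) + ('r + (bool \<times> 'n))"

definition chart_point :: "'r \<Rightarrow> (('r, 'p, 'n) par \<Rightarrow> complex) \<Rightarrow> 'r \<Rightarrow> complex" where
  "chart_point u0 x u = (if u = u0 then 1 else x (Inr (Inl u)))"

definition chart_kernel :: "'n \<Rightarrow> 'n \<Rightarrow> bool \<Rightarrow> (('r, 'p, 'n) par \<Rightarrow> complex) \<Rightarrow> 'n \<Rightarrow> complex" where
  "chart_kernel k l q x i =
    (if i = (if q then k else l) then 1 else if i = k \<or> i = l then 0 else x (Inr (Inr (q, i))))"

text \<open>The \<open>j\<close>-th component of the equation \<open>M\<^sub>v\<^sup>t a = 0\<close> is linear in the coefficients of \<open>M\<close>, and the
  coefficient at position \<open>(k, j, u0)\<close> enters it with factor \<open>a\<^sub>k v\<^sub>u\<^sub>0 = 1\<close>; likewise for the second kernel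
  vector and \<open>(l, j, u0)\<close>. So these coefficients are polynomials in the remaining ones, in \<open>v\<close> and in the
  kernel vectors. In each equation the coefficient solved for by the other one has factor \<open>0\<close>,
  which is why the sum may skip both.\<close>
definition chart_entry :: "'r \<times> 'n \<times> 'n \<Rightarrow> 'n \<times> 'p \<times> 'r \<Rightarrow> (('r::finite, 'p, 'n::finite) par \<Rightarrow> complex) \<Rightarrow> complex" where
  "chart_entry = (\<lambda>(u0, k, l) (i, j, u) x.
    if u = u0 \<and> (i = k \<or> i = l) then
      - (\<Sum>i'\<in>UNIV. \<Sum>u'\<in>UNIV. if u' = u0 \<and> (i' = k \<or> i' = l) then 0
           else chart_kernel k l (i = k) x i' * x (Inl (i', j, u')) * chart_point u0 x u')
    else x (Inl (i, j, u)))"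

definition chart_pars :: "'r \<times> 'n \<times> 'n \<Rightarrow> ('r::finite, 'p::finite, 'n::finite) par set" where
  "chart_pars = (\<lambda>(u0, k, l). (UNIV - {k, l} \<times> UNIV \<times> {u0}) <+>
     ((UNIV - {u0}) <+> (UNIV \<times> (UNIV - {k, l}))))"

lemma card_chart_pars:
  assumes "k \<noteq> (l :: 'n::finite)"
  shows "card (chart_pars (u0, k, l) :: ('r::finite, 'p::finite, 'n) par set)
    = CARD('n) * CARD('p) * CARD('r) - 2 * CARD('p) + (CARD('r) - 1 + 2 * (CARD('n) - 2))"
proof -
  have 1: "card (UNIV - {k, l} \<times> (UNIV :: 'p set) \<times> {u0 :: 'r})
      = CARD('n) * CARD('p) * CARD('r) - 2 * CARD('p)"
    using assms by (subst card_Diff_subset) (auto simp: card_cartesian_product UNIV_Times_UNIV[symmetric] mult_ac simp del: UNIV_Times_UNIV)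
  have 2: "card (UNIV - {k, l}) = CARD('n) - 2"
    using assms by (subst card_Diff_subset) auto
  have 3: "card (UNIV - {u0}) = CARD('r) - 1"
    by (subst card_Diff_subset) auto
  show ?thesis unfolding chart_pars_def
    by (simp add: card_Plus 1 2 3 card_cartesian_product)
qed

lemma poly_in_chart_entry:
  "poly_in (chart_pars t) 3 (chart_entry t j :: (('r::finite, 'p::finite, 'n::finite) par \<Rightarrow> complex) \<Rightarrow> complex)"
proof -
  obtain u0 k l where t: "t = (u0, k, l)" by (cases t)
  obtain i c u where j: "j = (i, c, u)" by (cases j)
  let ?I = "chart_pars t :: ('r, 'p, 'n) par set"
  have fin: "finite ?I" by simp
  have point: "poly_in ?I 1 (\<lambda>x. chart_point u0 x u')" for u'
    unfolding chart_point_def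
    by (cases "u' = u0") (auto intro!: poly_in_const poly_in_var fin simp: chart_pars_def t)
  have kernel: "poly_in ?I 1 (\<lambda>x. chart_kernel k l q x i')" for q i'
    unfolding chart_kernel_def
    by (cases "i' = (if q then k else l)"; cases "i' = k \<or> i' = l")
       (auto simp del: if_split intro!: poly_in_const poly_in_var fin simp: chart_pars_def t)
  have entry: "poly_in ?I 1 (\<lambda>x. x (Inl (i', c, u')))" if "\<not> (u' = u0 \<and> (i' = k \<or> i' = l))" for i' u'
    using that by (intro poly_in_var fin) (auto simp: chart_pars_def t)
  have "poly_in ?I 3 (\<lambda>x. if u' = u0 \<and> (i' = k \<or> i' = l) then 0
      else chart_kernel k l (i = k) x i' * x (Inl (i', c, u')) * chart_point u0 x u')" for i' u'
  proof (cases "u' = u0 \<and> (i' = k \<or> i' = l)")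
    case True
    then show ?thesis by (auto intro: poly_in_const fin)
  next
    case False
    have "poly_in ?I (1 + 1 + 1) (\<lambda>x. chart_kernel k l (i = k) x i' * x (Inl (i', c, u')) * chart_point u0 x u')"
      by (intro poly_in_mult fin kernel entry point False)
    then show ?thesis unfolding if_not_P[OF False] by (simp add: numeral_3_eq_3)
  qed
  then have "poly_in ?I (0 + 3) (\<lambda>x. (- 1) * (\<Sum>i'\<in>UNIV. \<Sum>u'\<in>UNIV. if u' = u0 \<and> (i' = k \<or> i' = l) then 0
      else chart_kernel k l (i = k) x i' * x (Inl (i', c, u')) * chart_point u0 x u'))"
    by (intro poly_in_mult poly_in_const poly_in_sum fin)
  moreover have "poly_in ?I 3 (\<lambda>x. x (Inl (i, c, u)))" if "\<not> (u = u0 \<and> (i = k \<or> i = l))"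
    by (intro poly_in_mono[OF fin entry[OF that]]) simp
  ultimately show ?thesis
    by (cases "u = u0 \<and> (i = k \<or> i = l)") (auto simp: t j chart_entry_def)
qed

text \<open>The charts cover the matrices with a left kernel of dimension at least two: the parameters are read
  off from the matrix and a normalized kernel.\<close>
lemma not_corank_at_most_one_parametrized:
  fixes M :: "('r::finite, 'p::finite, 'n::finite) linmat"
  assumes "\<not> corank_at_most_one M"
  obtains t x where "t \<in> {(u0, k, l). k \<noteq> l}" "\<And>i j u. chart_entry t (i, j, u) x = M $ i $ j $ u"
proof -
  obtain v a b u0 k l where v: "v $ u0 = 1" and kl: "k \<noteq> l"
    and a: "a $ k = 1" "a $ l = 0" "beta M a v = 0"
    and b: "b $ k = 0" "b $ l = 1" "beta M b v = 0"
    using not_corank_at_most_one_chart[OF assms] by metis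
  define x :: "('r, 'p, 'n) par \<Rightarrow> complex" where
    "x = case_sum (\<lambda>(i, j, u). M $ i $ j $ u) (case_sum (\<lambda>u. v $ u) (\<lambda>(q, i). if q then a $ i else b $ i))"
  have point: "chart_point u0 x u = v $ u" for u
    by (simp add: chart_point_def x_def v)
  have kernel: "chart_kernel k l q x i = (if q then a else b) $ i" for q i
    using a b kl by (auto simp: chart_kernel_def x_def)
  have solve: "- (\<Sum>i'\<in>UNIV. \<Sum>u'\<in>UNIV. if u' = u0 \<and> (i' = k \<or> i' = l) then 0
      else c $ i' * M $ i' $ j $ u' * v $ u') = M $ i $ j $ u0"
    if c: "c $ i = 1" "beta M c v = 0" and i: "i = k \<and> c $ l = 0 \<or> i = l \<and> c $ k = 0" for c i j
  proof -
    have "c $ i' * M $ i' $ j $ u' * v $ u'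
        = (if u' = u0 \<and> (i' = k \<or> i' = l) then 0 else c $ i' * M $ i' $ j $ u' * v $ u')
          + (if i' = i then if u' = u0 then M $ i $ j $ u0 else 0 else 0)" for i' u'
      using i c v kl by auto
    then have "beta M c v $ j = (\<Sum>i'\<in>UNIV. \<Sum>u'\<in>UNIV.
        (if u' = u0 \<and> (i' = k \<or> i' = l) then 0 else c $ i' * M $ i' $ j $ u' * v $ u')
          + (if i' = i then if u' = u0 then M $ i $ j $ u0 else 0 else 0))"
      unfolding beta_nth by presburger
    also have "\<dots> = (\<Sum>i'\<in>UNIV. \<Sum>u'\<in>UNIV.
        (if u' = u0 \<and> (i' = k \<or> i' = l) then 0 else c $ i' * M $ i' $ j $ u' * v $ u'))
          + (\<Sum>i'\<in>UNIV. if i' = i then M $ i $ j $ u0 else 0)"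
      unfolding sum.distrib by (intro arg_cong2[where f="(+)"] sum.cong refl) auto
    finally show ?thesis using c by (simp add: algebra_simps add_eq_0_iff)
  qed
  have "chart_entry (u0, k, l) (i, j, u) x = M $ i $ j $ u" for i j u
  proof -
    have xM: "x (Inl (i', j', u')) = M $ i' $ j' $ u'" for i' j' u' by (simp add: x_def)
    show ?thesis
      unfolding chart_entry_def prod.case point kernel xM
      using solve[of a k j] solve[of b l j] a b kl by auto
  qed
  then show ?thesis using that[of "(u0, k, l)" x] kl by simp
qed

text \<open>The locus where the rank of an \<open>n \<times> (n + m)\<close> matrix drops by two has codimension \<open>2 (m + 2)\<close>, which
  exceeds \<open>s\<close>. In terms of charts: the \<open>2 (n + m)\<close> coefficients that are solved for outnumber the
  \<open>s + 2 (n - 2)\<close> parameters of \<open>v\<close> and the kernel.\<close>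
lemma general_corank_at_most_one:
  fixes m s :: nat
  assumes "CARD('n::finite) \<ge> 2" "CARD('p::finite) = CARD('n) + m" "CARD('r::finite) = s + 1"
    and "s < 2 * m + 4"
  shows "\<exists>U :: ('r, 'p, 'n) linmat set. zariski_open U \<and> U \<noteq> {} \<and> (\<forall>M\<in>U. corank_at_most_one M)"
proof -
  let ?T = "{(u0 :: 'r, k :: 'n, l). k \<noteq> l}"
  let ?J = "UNIV :: ('n \<times> 'p \<times> 'r) set"
  have "card (chart_pars t :: ('r, 'p, 'n) par set) < card ?J" if "t \<in> ?T" for t
  proof -
    obtain u0 k l where t: "t = (u0, k, l)" "k \<noteq> l" using \<open>t \<in> ?T\<close> by (cases t) auto
    have card: "card ?J = CARD('n) * CARD('p) * CARD('r)"
      by (simp add: mult.assoc)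
    have "2 * CARD('p) \<le> CARD('n) * CARD('p) * CARD('r)"
      using mult_le_mono[OF mult_le_mono1[OF assms(1), of "CARD('p)"], of 1 "CARD('r)"] assms(3)
      by simp
    then show ?thesis
      unfolding t card_chart_pars[OF t(2)] card using assms by arith
  qed
  then obtain d c y where
    y: "(\<Sum>e\<in>PiE ?J (\<lambda>_. {..d}). c e * (\<Prod>j\<in>?J. y j ^ e j)) \<noteq> (0 :: complex)" and
    zero: "\<And>t x. t \<in> ?T \<Longrightarrow>
      (\<Sum>e\<in>PiE ?J (\<lambda>_. {..d}). c e * (\<Prod>j\<in>?J. chart_entry t j (x :: ('r, 'p, 'n) par \<Rightarrow> complex) ^ e j)) = 0"
    using parametrized_images_in_hypersurface[of ?J ?T chart_pars 3 chart_entry]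
    by (auto simp: poly_in_chart_entry)
  define f :: "('r, 'p, 'n) linmat \<Rightarrow> complex" where
    "f M = (\<Sum>e\<in>PiE ?J (\<lambda>_. {..d}). c e * (\<Prod>j\<in>?J. (case j of (i, j, u) \<Rightarrow> M $ i $ j $ u) ^ e j))" for M
  have "poly_fun f" unfolding f_def
    by (intro poly_fun_sum poly_fun.intros(4) poly_fun_prod poly_fun_power)
       (auto simp: case_prod_unfold intro: poly_fun.intros)
  then have "zariski_open {M. f M \<noteq> 0}"
    unfolding zariski_open_def by (intro exI[of _ "{f}"]) auto
  moreover have "f (\<chi> i j u. y (i, j, u)) \<noteq> 0"
    using y by (simp add: f_def case_prod_unfold)
  moreover have "corank_at_most_one M" if "f M \<noteq> 0" for M
  proof (rule ccontr)
    assume "\<not> corank_at_most_one M"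
    then obtain t x where t: "t \<in> ?T" and x: "\<And>i j u. chart_entry t (i, j, u) x = M $ i $ j $ u"
      using not_corank_at_most_one_parametrized by metis
    have "(case j of (i, j, u) \<Rightarrow> M $ i $ j $ u) = chart_entry t j x" for j
      by (cases j) (simp add: x)
    then show False using zero[OF t, of x] that by (simp add: f_def)
  qed
  ultimately show ?thesis by blast
qed

section \<open>Linear algebra of the bilinear form, points and lines\<close>

lemma bil_sym: "bil x y = bil y x"
  by (simp add: bil_def mult.commute)

lemma bil_simps:
  "bil (x + x') y = bil x y + bil x' y" "bil (c *s x) y = c * bil x y" "bil 0 y = 0"
  "bil y (x + x') = bil y x + bil y x'" "bil y (c *s x) = c * bil y x" "bil y 0 = 0"
  by (simp_all add: bil_def algebra_simps sum.distrib sum_distrib_left)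

lemma subspace_perp: "vec.subspace (perp W)"
  unfolding vec.subspace_def perp_def
  by (auto simp: bil_simps)

text \<open>Extend a basis of \<open>W\<close> to a basis of the whole space. Pairing with this basis is an isomorphism that
  maps the orthogonal complement of \<open>W\<close> onto a coordinate subspace.\<close>
lemma dim_perp:
  fixes W :: "(complex^'k::finite) set"
  assumes "vec.subspace W"
  shows "vec.dim (perp W) = CARD('k) - vec.dim W"
proof -
  obtain B where B: "B \<subseteq> W" "vec.independent B" "W \<subseteq> vec.span B" "card B = vec.dim W"
    using vec.basis_exists by blast
  define B' where "B' = vec.extend_basis B"
  have B': "B \<subseteq> B'" "vec.independent B'" "vec.span B' = UNIV"
    unfolding B'_def using B(2)
    by (simp_all add: vec.extend_basis_superset vec.independent_extend_basis)
  have fin: "finite B'" using B'(2) by (rule vec.finiteI_independent)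
  have "card B' = CARD('k)"
    using vec.dim_eq_card[of B' UNIV] B' by (simp add: card_cart_basis)
  then obtain g :: "'k \<Rightarrow> complex^'k" where g: "bij_betw g UNIV B'"
    using fin by (metis finite finite_same_card_bij)
  define A :: "complex^'k \<Rightarrow> complex^'k" where "A y = (\<chi> i. bil (g i) y)" for y
  have zero_if: "y = 0" if "\<And>x. x \<in> B' \<Longrightarrow> bil x y = 0" for y
  proof -
    have "vec.span B' \<subseteq> {x. bil x y = 0}"
      by (rule vec.span_minimal) (use that in \<open>auto simp: vec.subspace_def bil_simps\<close>)
    then have "bil (axis i 1) y = 0" for i using B'(3) by auto
    then have "y $ i = 0" for i
      using that by (simp add: bil_def axis_def if_distrib[where f="\<lambda>z. z * _"] cong: if_cong)
    then show ?thesis by (simp add: vec_eq_iff)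
  qed
  have lin: "Vector_Spaces.linear (*s) (*s) A"
    by unfold_locales (auto simp: A_def vec_eq_iff bil_def algebra_simps sum.distrib sum_distrib_left)
  have inj: "inj A"
  proof (rule vec.linear_inj_iff_eq_0[OF lin, THEN iffD2], intro allI impI)
    fix y assume "A y = 0"
    then have "bil (g i) y = 0" for i by (simp add: A_def vec_eq_iff)
    then show "y = 0" using g by (intro zero_if) (auto simp: bij_betw_def)
  qed
  then have surj: "surj A" using lin by (rule vec.linear_inj_imp_surj[rotated])
  define d where "d = {i. g i \<notin> B}"
  have "y \<in> perp W \<longleftrightarrow> (\<forall>i. i \<notin> d \<longrightarrow> A y $ i = 0)" for y
  proof
    assume "y \<in> perp W"
    then show "\<forall>i. i \<notin> d \<longrightarrow> A y $ i = 0"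
      using B(1) by (auto simp: perp_def A_def d_def)
  next
    assume A: "\<forall>i. i \<notin> d \<longrightarrow> A y $ i = 0"
    have "bil x y = 0" if "x \<in> B" for x
    proof -
      obtain i where "g i = x" using g \<open>x \<in> B\<close> B'(1) by (auto simp: bij_betw_def)
      then show ?thesis using A that by (auto simp: A_def d_def)
    qed
    then have "vec.span B \<subseteq> {x. bil x y = 0}"
      by (intro vec.span_minimal) (auto simp: vec.subspace_def bil_simps)
    then show "y \<in> perp W" using B(3) by (auto simp: perp_def)
  qed
  then have perp_eq: "perp W = A -` {z. \<forall>i. i \<notin> d \<longrightarrow> z $ i = 0}" by auto
  have "A ` perp W = {z. \<forall>i. i \<notin> d \<longrightarrow> z $ i = 0}"
    unfolding perp_eq using surj by (rule surj_image_vimage_eq)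
  then have "vec.dim (perp W) = card d"
    using vec.dim_image_eq[OF lin inj_on_subset[OF inj subset_UNIV], of "perp W"] dim_substandard_cart[where 'a=complex, of d]
    by simp
  moreover have "card d = CARD('k) - vec.dim W"
  proof -
    have "card (UNIV - d) = card B"
      using g B'(1) by (intro bij_betw_same_card[of g])
        (auto simp: bij_betw_def d_def inj_on_def image_iff)
    moreover have "card (UNIV - d) = CARD('k) - card d" by (rule card_Diff_subset) auto
    moreover have "card d \<le> CARD('k)" by (simp add: card_mono)
    ultimately show ?thesis using B(4) by simp
  qed
  ultimately show ?thesis by simp
qed

lemma rank_le_iff_left_kernel:
  "rank (ev M v) \<le> CARD('n) - 1 \<longleftrightarrow> (\<exists>a. a \<noteq> 0 \<and> beta M a v = 0)"
  for M :: "('r::finite, 'p::finite, 'n::finite) linmat"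
proof -
  have beta_rows: "beta M a v = (\<Sum>i\<in>UNIV. a $ i *s row i (ev M v))" for a
    by (simp add: vec_eq_iff beta_nth row_def ev_def sum_distrib_left mult_ac)
  have rows: "rows (ev M v) = (\<lambda>i. row i (ev M v)) ` UNIV"
    by (auto simp: rows_def)
  have lin: "Vector_Spaces.linear (*s) (*s) (\<lambda>a. beta M a v)"
    by unfold_locales (auto simp: beta_simps)
  show ?thesis
  proof
    assume rank: "rank (ev M v) \<le> CARD('n) - 1"
    show "\<exists>a. a \<noteq> 0 \<and> beta M a v = 0"
    proof (rule ccontr)
      assume "\<nexists>a. a \<noteq> 0 \<and> beta M a v = 0"
      then have "inj (\<lambda>a. beta M a v)"
        using vec.linear_inj_iff_eq_0[OF lin] by blast
      then have "vec.dim (range (\<lambda>a. beta M a v)) = CARD('n)"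
        using vec.dim_image_eq[OF lin, of UNIV] by (simp add: card_cart_basis)
      moreover have "range (\<lambda>a. beta M a v) \<subseteq> vec.span (rows (ev M v))"
        unfolding beta_rows rows
        by (clarify, rule vec.span_sum, rule vec.span_scale, rule vec.span_base) simp
      ultimately have "CARD('n) \<le> rank (ev M v)"
        unfolding row_rank_def_gen by (metis vec.dim_span vec.dim_subset)
      moreover have "CARD('n) > 0" by simp
      ultimately show False using rank by linarith
    qed
  next
    assume "\<exists>a. a \<noteq> 0 \<and> beta M a v = 0"
    then obtain a where a: "a \<noteq> 0" "beta M a v = 0" by blast
    then obtain k where k: "a $ k \<noteq> 0" by (auto simp: vec_eq_iff)
    let ?R = "(\<lambda>i. row i (ev M v)) ` (UNIV - {k})"
    have "a $ k *s row k (ev M v) = - (\<Sum>i\<in>UNIV - {k}. a $ i *s row i (ev M v))"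
      using a(2) unfolding beta_rows by (simp add: sum.remove[of UNIV k] add_eq_0_iff2)
    also have "\<dots> \<in> vec.span ?R"
      by (intro vec.span_neg vec.span_sum vec.span_scale, rule vec.span_base) simp
    finally have "inverse (a $ k) *s (a $ k *s row k (ev M v)) \<in> vec.span ?R"
      by (rule vec.span_scale)
    then have "row k (ev M v) \<in> vec.span ?R" using k by simp
    then have "rows (ev M v) \<subseteq> vec.span ?R"
      unfolding rows by (auto intro: vec.span_base)
    then have "rank (ev M v) \<le> card ?R"
      unfolding row_rank_def_gen by (intro vec.dim_le_card) auto
    also have "\<dots> \<le> card (UNIV - {k})" by (rule card_image_le) simp
    finally show "rank (ev M v) \<le> CARD('n) - 1" by (simp add: card_Diff_subset)
  qed
qed

lemma in_pt: "w \<in> pt v \<longleftrightarrow> (\<exists>c. w = c *s v)"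
  by (auto simp: pt_def vec.span_singleton)

lemma pt_scale:
  assumes "c \<noteq> 0"
  shows "pt (c *s v) = pt v"
proof (intro set_eqI iffI)
  fix w assume "w \<in> pt v"
  then obtain d where "w = d *s v" by (auto simp: in_pt)
  then have "w = (d / c) *s (c *s v)" using assms by simp
  then show "w \<in> pt (c *s v)" unfolding in_pt by blast
qed (auto simp: in_pt)

lemma self_in_pt: "v \<in> pt v"
  unfolding in_pt by (rule exI[of _ 1]) simp

lemma pt_eq:
  assumes "w \<noteq> 0"
  shows "pt v = pt w \<longleftrightarrow> w \<in> pt v"
proof
  assume "w \<in> pt v"
  then obtain c where c: "w = c *s v" by (auto simp: in_pt)
  then have "c \<noteq> 0" using assms by auto
  then show "pt v = pt w" using c by (simp add: pt_scale)
qed (simp add: self_in_pt)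

lemma in_span_pair: "u \<in> vec.span {v, w} \<longleftrightarrow> (\<exists>x y. u = x *s v + y *s w)"
proof -
  have "(\<exists>x y. u - x *s v = y *s w) \<longleftrightarrow> (\<exists>x y. u = x *s v + y *s w)"
    by (auto simp: algebra_simps)
  then show ?thesis by (auto simp: vec.span_breakdown_eq[of u v "{w}"] vec.span_singleton)
qed

lemma pt_in_proj_space: "pt v \<in> proj_space \<longleftrightarrow> v \<noteq> 0"
  unfolding Gr_def pt_def
  by (auto simp: vec.dim_singleton vec.dim_eq_card_independent vec.subspace_span)

lemma proj_spaceE:
  assumes "L \<in> proj_space"
  obtains v where "v \<noteq> 0" "L = pt v"
proof -
  have sub: "vec.subspace L" and dim: "vec.dim L = 1" using assms by (auto simp: Gr_def)
  then obtain v where v: "v \<in> L" "v \<noteq> 0"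
    by (metis vec.dim_eq_0 subsetI singletonI zero_neq_one singleton_iff)
  then have "pt v \<subseteq> L" unfolding pt_def using sub by (intro vec.span_minimal) auto
  then have "pt v = L"
    using pt_in_proj_space[of v] v dim sub
    by (intro vec.subspace_dim_equal) (auto simp: Gr_def)
  then show ?thesis using that v by blast
qed

lemma pt_in_proj_sub:
  assumes "vec.subspace \<rho>"
  shows "pt v \<in> proj_sub \<rho> \<longleftrightarrow> v \<noteq> 0 \<and> v \<in> \<rho>"
proof -
  have "pt v \<subseteq> \<rho> \<longleftrightarrow> v \<in> \<rho>"
    using self_in_pt[of v] vec.span_minimal[of "{v}" \<rho>] assms unfolding pt_def by blast
  then show ?thesis by (auto simp: proj_sub_def pt_in_proj_space simp del: One_nat_def)
qed

lemma independent_pairD: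
  assumes "v \<noteq> 0" "w \<notin> pt v" "x *s v + y *s w = 0"
  shows "x = 0 \<and> y = 0"
proof -
  have "y = 0"
  proof (rule ccontr)
    assume "y \<noteq> 0"
    then have "w = (- x / y) *s v"
      using assms(3) by (simp add: vec_eq_iff field_simps add_eq_0_iff)
    then show False using assms(2) in_pt by blast
  qed
  then show ?thesis using assms(1,3) by simp
qed

lemma dim_span_pair:
  assumes "v \<noteq> 0" "w \<notin> pt v"
  shows "vec.dim (vec.span {v, w}) = 2"
proof -
  have "vec.independent {w, v}"
    using assms by (simp add: vec.independent_insert pt_def)
  moreover have "card {w, v} = 2" using assms by (auto simp: card_insert_if self_in_pt)
  ultimately show ?thesis by (metis vec.dim_span vec.dim_eq_card_independent insert_commute)
qed

lemma Gr2_eq_span: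
  assumes "\<rho> \<in> Gr 2" "v \<in> \<rho>" "w \<in> \<rho>" "v \<noteq> 0" "w \<notin> pt v"
  shows "\<rho> = vec.span {v, w}"
proof -
  have "vec.span {v, w} \<subseteq> \<rho>"
    using assms by (intro vec.span_minimal) (auto simp: Gr_def)
  then show ?thesis
    using assms dim_span_pair[of v w]
    by (intro vec.subspace_dim_equal[symmetric]) (auto simp: Gr_def)
qed

lemma Gr2_not_in_pt:
  assumes "\<rho> \<in> Gr 2"
  obtains w where "w \<in> \<rho>" "w \<notin> pt v"
proof -
  have "\<not> \<rho> \<subseteq> vec.span {v}"
  proof
    assume "\<rho> \<subseteq> vec.span {v}"
    then have "vec.dim \<rho> \<le> card {v}" by (rule vec.dim_le_card) simp
    then show False using assms by (simp add: Gr_def)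
  qed
  then show ?thesis using that unfolding pt_def by blast
qed

lemma Gr2_basis:
  assumes "\<rho> \<in> Gr 2"
  obtains v w where "v \<in> \<rho>" "w \<in> \<rho>" "v \<noteq> 0" "w \<notin> pt v" "\<rho> = vec.span {v, w}"
proof -
  obtain v where v: "v \<in> \<rho>" "v \<notin> pt 0" using Gr2_not_in_pt[OF assms] .
  obtain w where w: "w \<in> \<rho>" "w \<notin> pt v" using Gr2_not_in_pt[OF assms] .
  have "v \<noteq> 0" using v by (auto simp: in_pt)
  then show ?thesis using that v w Gr2_eq_span[OF assms v(1) w(1)] by blast
qed

lemma pt_in_S: "pt v \<in> S M \<longleftrightarrow> v \<noteq> 0 \<and> (\<exists>a. a \<noteq> 0 \<and> beta M a v = 0)"
proof -
  have "beta M a u = 0" if "u \<in> pt v" "beta M a v = 0" for a u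
    using that by (auto simp: in_pt beta_simps)
  moreover have "v \<in> pt v" by (rule self_in_pt)
  ultimately show ?thesis
    unfolding S_def by (auto simp: pt_in_proj_space rank_le_iff_left_kernel simp del: One_nat_def)
qed

lemma alpha_kernel:
  assumes "v \<noteq> 0" "a \<noteq> 0" "beta M a v = 0"
  shows "alpha M (pt v) \<noteq> 0" "beta M (alpha M (pt v)) v = 0"
proof -
  have "\<forall>u\<in>pt v. transpose (ev M u) *v a = 0"
    unfolding beta_def[symmetric] using assms by (auto simp: in_pt beta_simps)
  with assms(2) have "alpha M (pt v) \<noteq> 0 \<and> (\<forall>u\<in>pt v. transpose (ev M u) *v alpha M (pt v) = 0)"
    unfolding alpha_def by (intro someI_ex[where P="\<lambda>a. a \<noteq> 0 \<and> (\<forall>u\<in>pt v. transpose (ev M u) *v a = 0)"]) auto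
  moreover have "v \<in> pt v" by (rule self_in_pt)
  ultimately show "alpha M (pt v) \<noteq> 0" "beta M (alpha M (pt v)) v = 0"
    by (auto simp: beta_def)
qed

lemma alpha_in_pt:
  assumes "corank_at_most_one M" "v \<noteq> 0" "a \<noteq> 0" "beta M a v = 0"
  shows "alpha M (pt v) \<in> pt a"
  using assms alpha_kernel[OF assms(2-4)] unfolding corank_at_most_one_def in_pt by blast

lemma psi_eq:
  assumes "corank_at_most_one M" "v \<noteq> 0" "a \<noteq> 0" "beta M a v = 0"
  shows "psi M (pt v) = pt a"
  unfolding psi_def
  using pt_eq[of "alpha M (pt v)" a] alpha_in_pt[OF assms] alpha_kernel[OF assms(2-4)] by auto

text \<open>The hypothesis says that \<open>a + t b\<close> annihilates \<open>M\<^sub>v + t M\<^sub>x\<close> from the left up to an error of order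
  \<open>t\<^sup>2\<close>. Replacing a row \<open>k\<close> with \<open>a\<^sub>k \<noteq> 0\<close> by this combination of the rows multiplies a maximal minor by
  \<open>a\<^sub>k + t b\<^sub>k\<close> and makes a row divisible by \<open>t\<^sup>2\<close>. So the minor vanishes to second order at \<open>t = 0\<close>.\<close>
lemma singular_pencil_double_root:
  fixes M :: "('r::finite, 'p::finite, 'n::finite) linmat"
  assumes "a \<noteq> 0" "beta M a v = 0" "beta M a x + beta M b v = 0"
  shows "((\<lambda>t::complex. max_minor M c (v + t *s x)) has_field_derivative 0) (at 0)"
proof -
  obtain k where k: "a $ k \<noteq> 0" using assms(1) by (auto simp: vec_eq_iff)
  define N :: "complex \<Rightarrow> complex^'n^'n" where "N t = (\<chi> i j. ev M (v + t *s x) $ i $ c j)" for t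
  define z :: "complex^'n" where "z = (\<chi> j. beta M b x $ c j)"
  define g where "g t = det (\<chi> i. if i = k then z else row i (N t))" for t
  have expand: "beta M (a + t *s b) (v + t *s x) = (t ^ 2) *s beta M b x" for t
    using assms(2,3) by (simp add: beta_simps vec_eq_iff algebra_simps power2_eq_square)
       (metis (no_types, lifting) add.commute add_eq_0_iff mult_minus_right)
  have combination: "(\<Sum>i\<in>UNIV. (a + t *s b) $ i *s row i (N t)) = (t ^ 2) *s z" for t
  proof -
    have "(\<Sum>i\<in>UNIV. y $ i *s row i (\<chi> i j. ev M u $ i $ c j)) $ j = beta M y u $ c j" for y u j
      by (simp add: beta_nth N_def ev_def row_def sum_distrib_left mult_ac)
    from this[of "a + t *s b" "v + t *s x"] show ?thesis
      unfolding N_def expand by (simp add: vec_eq_iff z_def)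
  qed
  have "(a $ k + t * b $ k) * det (N t) = t ^ 2 * g t" for t
    using cramer_lemma_transpose[where x="a + t *s b" and k=k and A="N t", unfolded combination]
    by (simp add: g_def det_row_mul)
  then have g: "(a $ k + t * b $ k) * max_minor M c (v + t *s x) = t ^ 2 * g t" for t
    by (simp add: max_minor_def N_def)
  have minor_0: "max_minor M c v = 0" using g[of 0] k by simp
  have g_poly: "g = (\<lambda>t. \<Sum>p | p permutes UNIV. of_int (sign p) *
      (\<Prod>i\<in>UNIV. if i = k then z $ p i else \<Sum>u\<in>UNIV. M $ i $ c (p i) $ u * (v $ u + t * x $ u)))"
    by (auto simp: fun_eq_iff g_def det_def N_def row_def ev_def intro!: sum.cong prod.cong)
  have "isCont (\<lambda>t. if i = k then z $ p i else \<Sum>u\<in>UNIV. M $ i $ c (p i) $ u * (v $ u + t * x $ u)) 0" for i p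
    by (cases "i = k") (auto intro!: continuous_intros)
  then have "isCont g 0"
    unfolding g_poly by (intro continuous_intros)
  then have "((\<lambda>t. t * g t / (a $ k + t * b $ k)) \<longlongrightarrow> 0 * g 0 / (a $ k + 0 * b $ k)) (at 0)"
    using k by (intro tendsto_intros) (auto simp: isCont_def)
  moreover have "\<forall>\<^sub>F t in at 0. t * g t / (a $ k + t * b $ k) =
      (max_minor M c (v + t *s x) - max_minor M c (v + 0 *s x)) / (t - 0)"
  proof -
    have "((\<lambda>t. a $ k + t * b $ k) \<longlongrightarrow> a $ k + 0 * b $ k) (at 0)" by (intro tendsto_intros)
    then have "\<forall>\<^sub>F t in at 0. a $ k + t * b $ k \<noteq> 0"
      using k by (intro tendsto_imp_eventually_ne) auto
    moreover have "\<forall>\<^sub>F t in at (0::complex). t \<noteq> 0" by (simp add: eventually_at_filter)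
    ultimately show ?thesis
    proof eventually_elim
      case (elim t)
      then show ?case using g[of t] minor_0 by (simp add: field_simps power2_eq_square)
    qed
  qed
  ultimately show ?thesis
    unfolding has_field_derivative_iff by (auto intro: Lim_transform_eventually)
qed

lemma binary_quadratic_root:
  fixes A B C :: complex
  obtains s t where "(s, t) \<noteq> (0, 0)" "A * s\<^sup>2 + B * s * t + C * t\<^sup>2 = 0"
proof (cases "A = 0")
  case True
  then show ?thesis using that[of 1 0] by simp
next
  case False
  define e where "e = csqrt (B\<^sup>2 - 4 * A * C)"
  have "e\<^sup>2 = B\<^sup>2 - 4 * A * C" by (simp add: e_def)
  then have "A * (e - B)\<^sup>2 + B * (e - B) * (2 * A) + C * (2 * A)\<^sup>2 = 0"
    by algebra
  then show ?thesis using that[of "e - B" "2 * A"] False by simp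
qed

lemma singular_2x2:
  fixes p q r s :: "'a::field"
  assumes "p * s = q * r"
  obtains x y where "(x, y) \<noteq> (0, 0)" "x * p + y * r = 0" "x * q + y * s = 0"
proof (cases "p = 0 \<and> r = 0")
  case True
  show ?thesis
  proof (cases "q = 0 \<and> s = 0")
    case True
    with \<open>p = 0 \<and> r = 0\<close> show ?thesis using that[of 1 0] by simp
  next
    case False
    with \<open>p = 0 \<and> r = 0\<close> show ?thesis using that[of s "- q"] by auto
  qed
next
  case False
  then show ?thesis using that[of r "- p"] assms by (auto simp: algebra_simps)
qed

section \<open>Classification of the zeros of the section\<close>

text \<open>A point of \<open>Z\<close> for a matrix that is general in the sense of the dimension count.\<close>
locale zero_of_section =
  fixes M :: "('r::finite, 'p::finite, 'n::finite) linmat" and \<rho>1 \<rho>2 \<rho>3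
  assumes corank: "corank_at_most_one M"
    and zero: "(\<rho>1, \<rho>2, \<rho>3) \<in> Z M"
    and two_le: "2 \<le> CARD('p)"
begin

lemma \<rho>1: "\<rho>1 \<in> Gr 2" and \<rho>2: "\<rho>2 \<in> Gr 2" and \<rho>3: "\<rho>3 \<in> Gr (CARD('p) - 2)"
  using zero by (auto simp: Z_def)

lemma subspace: "vec.subspace \<rho>1" "vec.subspace \<rho>2" "vec.subspace \<rho>3"
  using \<rho>1 \<rho>2 \<rho>3 by (auto simp: Gr_def)

lemma perp_\<rho>3: "perp \<rho>3 \<in> Gr 2"
  using dim_perp[OF subspace(3)] \<rho>3 two_le by (simp add: Gr_def subspace_perp)

lemma beta_in_perp:
  assumes "a \<in> \<rho>1" "u \<in> \<rho>2"
  shows "beta M a u \<in> perp \<rho>3"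
proof -
  have "bil b (beta M a u) = omega M a u b" for b
    unfolding bil_def omega_def beta_def matrix_vector_mult_def transpose_def
    by (simp add: sum_distrib_left) (subst sum.swap, simp add: mult_ac)
  then show ?thesis using zero assms by (auto simp: Z_def perp_def)
qed

definition incident :: "complex^'r \<Rightarrow> bool" where
  "incident u \<longleftrightarrow> u \<in> \<rho>2 \<and> u \<noteq> 0 \<and> (\<exists>a\<in>\<rho>1. a \<noteq> 0 \<and> beta M a u = 0)"

lemma incident_in_S: "incident u \<Longrightarrow> pt u \<in> S M"
  by (auto simp: incident_def pt_in_S)

lemma incident_alpha:
  assumes "incident u"
  shows "alpha M (pt u) \<in> \<rho>1" "alpha M (pt u) \<noteq> 0" "beta M (alpha M (pt u)) u = 0"
proof -
  from assms obtain a where a: "u \<noteq> 0" "a \<in> \<rho>1" "a \<noteq> 0" "beta M a u = 0"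
    by (auto simp: incident_def)
  show "alpha M (pt u) \<noteq> 0" "beta M (alpha M (pt u)) u = 0"
    using alpha_kernel[OF a(1,3,4)] .
  show "alpha M (pt u) \<in> \<rho>1"
    using alpha_in_pt[OF corank a(1,3,4)] a(2) subspace(1) by (auto simp: in_pt vec.subspace_scale)
qed

lemma incidentI:
  assumes "pt u \<in> S M" "u \<in> \<rho>2" "alpha M (pt u) \<in> \<rho>1"
  shows "incident u"
proof -
  from assms(1) obtain a where "u \<noteq> 0" "a \<noteq> 0" "beta M a u = 0" by (auto simp: pt_in_S)
  then show ?thesis
    using assms(2,3) alpha_kernel[of u a M] unfolding incident_def by blast
qed

text \<open>The determinant of the pencil of \<open>2 \<times> 2\<close> matrices \<open>a \<mapsto> M\<^sub>u\<^sup>t a\<close>, \<open>u \<in> \<rho>\<^sub>2\<close>, is a binary quadratic form,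
  which has a complex zero.\<close>
lemma exists_incident: "\<exists>u. incident u"
proof -
  obtain a1 a2 where a: "a1 \<in> \<rho>1" "a2 \<in> \<rho>1" "a1 \<noteq> 0" "a2 \<notin> pt a1" using Gr2_basis[OF \<rho>1] .
  obtain u1 u2 where u: "u1 \<in> \<rho>2" "u2 \<in> \<rho>2" "u1 \<noteq> 0" "u2 \<notin> pt u1" using Gr2_basis[OF \<rho>2] .
  obtain w1 w2 where w: "perp \<rho>3 = vec.span {w1, w2}" using Gr2_basis[OF perp_\<rho>3] .
  have "\<exists>p q. beta M a u = p *s w1 + q *s w2" if "a \<in> \<rho>1" "u \<in> \<rho>2" for a u
    using beta_in_perp[OF that] unfolding w in_span_pair .
  then obtain p11 q11 p12 q12 p21 q21 p22 q22 where coords: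
    "beta M a1 u1 = p11 *s w1 + q11 *s w2" "beta M a1 u2 = p12 *s w1 + q12 *s w2"
    "beta M a2 u1 = p21 *s w1 + q21 *s w2" "beta M a2 u2 = p22 *s w1 + q22 *s w2"
    using a u by meson
  obtain s t where st: "(s, t) \<noteq> (0, 0)"
    "(p11 * q21 - q11 * p21) * s\<^sup>2 + (p11 * q22 + p12 * q21 - q11 * p22 - q12 * p21) * s * t
      + (p12 * q22 - q12 * p22) * t\<^sup>2 = 0"
    using binary_quadratic_root by blast
  have "(s * p11 + t * p12) * (s * q21 + t * q22) = (s * q11 + t * q12) * (s * p21 + t * p22)"
    using st(2) by algebra
  then obtain x y where xy: "(x, y) \<noteq> (0, 0)"
    "x * (s * p11 + t * p12) + y * (s * p21 + t * p22) = 0"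
    "x * (s * q11 + t * q12) + y * (s * q21 + t * q22) = 0"
    using singular_2x2 by blast
  have "beta M (x *s a1 + y *s a2) (s *s u1 + t *s u2)
      = (x * (s * p11 + t * p12) + y * (s * p21 + t * p22)) *s w1
        + (x * (s * q11 + t * q12) + y * (s * q21 + t * q22)) *s w2"
    by (simp add: beta_simps coords vec_eq_iff algebra_simps)
  then have "beta M (x *s a1 + y *s a2) (s *s u1 + t *s u2) = 0" by (simp add: xy)
  moreover have "x *s a1 + y *s a2 \<noteq> 0" "s *s u1 + t *s u2 \<noteq> 0"
    using independent_pairD[OF a(3,4)] independent_pairD[OF u(3,4)] xy(1) st(1) by blast+
  moreover have "x *s a1 + y *s a2 \<in> \<rho>1" "s *s u1 + t *s u2 \<in> \<rho>2"
    using a u subspace by (simp_all add: vec.subspace_add vec.subspace_scale)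
  ultimately show ?thesis unfolding incident_def by blast
qed

text \<open>Write \<open>a = \<alpha>\<^sub>v\<close> and \<open>b = \<alpha>\<^sub>w\<close>. For \<open>c = p a + r b\<close> and \<open>u = z v + t w\<close> bilinearity leaves
  \<open>M\<^sub>u\<^sup>t c = p t M\<^sub>w\<^sup>t a + r z M\<^sub>v\<^sup>t b\<close>. If the two vectors on the right were dependent, then \<open>p\<close> and \<open>r\<close> could be
  chosen for every \<open>u\<close> to make this zero, and all points of \<open>[\<rho>\<^sub>2]\<close> would be incident. So they form
  a basis of \<open>\<rho>\<^sub>3\<^sup>\<bottom>\<close>, and the expression is zero only if \<open>u\<close> is a multiple of \<open>v\<close> or of \<open>w\<close>.\<close>
lemma two_incident_points:
  assumes "incident v" "incident w" "pt v \<noteq> pt w" "u \<in> \<rho>2" "u \<noteq> 0" "\<not> incident u"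
  shows "\<rho>1 = vec.span {alpha M (pt v), alpha M (pt w)}" "\<rho>2 = vec.span {v, w}"
    "vec.dim (pi_sp M v w) = 2" "perp (pi_sp M v w) = \<rho>3"
    "\<And>u. incident u \<Longrightarrow> pt u = pt v \<or> pt u = pt w"
proof -
  define a b where "a = alpha M (pt v)" and "b = alpha M (pt w)"
  have v: "v \<in> \<rho>2" "v \<noteq> 0" and w: "w \<in> \<rho>2" "w \<noteq> 0" using assms by (auto simp: incident_def)
  have a: "a \<in> \<rho>1" "a \<noteq> 0" "beta M a v = 0" and b: "b \<in> \<rho>1" "b \<noteq> 0" "beta M b w = 0"
    using incident_alpha assms(1,2) unfolding a_def b_def by auto
  have "w \<notin> pt v" using pt_eq[OF w(2)] assms(3) by blast
  then show \<rho>2_span: "\<rho>2 = vec.span {v, w}"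
    using Gr2_eq_span[OF \<rho>2 v(1) w(1) v(2)] by blast
  have coords: "\<exists>z t. u = z *s v + t *s w" if "u \<in> \<rho>2" for u
    using that unfolding \<rho>2_span in_span_pair .
  obtain z t where u: "u = z *s v + t *s w" using coords[OF assms(4)] by blast
  have "beta M a u \<noteq> 0" "beta M b u \<noteq> 0" using assms(4-6) a b unfolding incident_def by blast+
  then have zt: "z \<noteq> 0" "t \<noteq> 0" and aw: "beta M a w \<noteq> 0" and bv: "beta M b v \<noteq> 0"
    using a b by (auto simp: u beta_simps)
  have ba: "b \<notin> pt a"
    using a b aw by (auto simp: in_pt beta_simps)
  then show \<rho>1_span: "\<rho>1 = vec.span {alpha M (pt v), alpha M (pt w)}"
    using Gr2_eq_span[OF \<rho>1 a(1) b(1) a(2)] by (simp add: a_def b_def)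
  have indep: "x = 0 \<and> y = 0" if "x *s beta M a w + y *s beta M b v = 0" for x y
  proof (rule ccontr)
    assume xy: "\<not> (x = 0 \<and> y = 0)"
    define c where "c = (x * z) *s a + (y * t) *s b"
    have "beta M c u = (z * t) *s (x *s beta M a w + y *s beta M b v)"
      by (simp add: c_def u beta_simps a b vec_eq_iff algebra_simps)
    then have "beta M c u = 0" using that by simp
    moreover have "c \<noteq> 0" using independent_pairD[OF a(2) ba, of "x * z" "y * t"] zt xy by (auto simp: c_def)
    moreover have "c \<in> \<rho>1" using a b subspace by (simp add: c_def vec.subspace_add vec.subspace_scale)
    ultimately show False using assms(4-6) unfolding incident_def by blast
  qed
  have pi: "pi_sp M v w = vec.span {beta M b v, beta M a w}"
    by (simp add: pi_sp_def beta_def a_def b_def)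
  have aw_bv: "beta M a w \<notin> pt (beta M b v)"
  proof
    assume "beta M a w \<in> pt (beta M b v)"
    then obtain c where "beta M a w = c *s beta M b v" by (auto simp: in_pt)
    then show False using indep[of 1 "- c"] by simp
  qed
  then show dim: "vec.dim (pi_sp M v w) = 2" unfolding pi by (rule dim_span_pair[OF bv])
  have "perp \<rho>3 = pi_sp M v w"
    unfolding pi using aw_bv bv v w a b
    by (intro Gr2_eq_span[OF perp_\<rho>3] beta_in_perp) auto
  moreover have "\<rho>3 \<subseteq> perp (perp \<rho>3)" by (auto simp: perp_def bil_sym)
  moreover have "vec.dim (perp (pi_sp M v w)) = vec.dim \<rho>3"
    using dim_perp[of "pi_sp M v w"] dim \<rho>3 by (simp add: pi_sp_def Gr_def)
  ultimately show "perp (pi_sp M v w) = \<rho>3"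
    using subspace(3) subspace_perp by (intro vec.subspace_dim_equal[symmetric]) auto
  show "pt u = pt v \<or> pt u = pt w" if "incident u" for u
  proof -
    from that obtain c where c: "u \<in> \<rho>2" "u \<noteq> 0" "c \<in> \<rho>1" "c \<noteq> 0" "beta M c u = 0"
      by (auto simp: incident_def)
    obtain z t where u: "u = z *s v + t *s w" using coords[OF c(1)] by blast
    obtain p r where cpr: "c = p *s a + r *s b"
      using c(3) unfolding \<rho>1_span in_span_pair a_def b_def by blast
    have "(p * t) *s beta M a w + (r * z) *s beta M b v = beta M c u"
      by (simp add: cpr u beta_simps a b vec_eq_iff algebra_simps)
    then have "p * t = 0" "r * z = 0" using indep c(5) by metis+
    moreover have "p \<noteq> 0 \<or> r \<noteq> 0" using c(4) cpr by auto
    ultimately have "t = 0 \<or> z = 0" by auto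
    then show ?thesis
    proof
      assume "t = 0"
      then show ?thesis using u c(2) by (cases "z = 0") (auto simp: pt_scale)
    next
      assume "z = 0"
      then show ?thesis using u c(2) by (cases "t = 0") (auto simp: pt_scale)
    qed
  qed
qed

text \<open>Let \<open>a\<close> and \<open>v\<close> be extended to bases \<open>a, b\<close> of \<open>\<rho>\<^sub>1\<close> and \<open>v, w\<close> of \<open>\<rho>\<^sub>2\<close>. If \<open>M\<^sub>w\<^sup>t a\<close> were not a multiple of
  \<open>M\<^sub>v\<^sup>t b\<close>, these two vectors would span \<open>\<rho>\<^sub>3\<^sup>\<bottom>\<close>, and subtracting from \<open>w\<close> and \<open>b\<close> the multiples of
  \<open>v\<close> and \<open>a\<close> read off from the coordinates of \<open>M\<^sub>w\<^sup>t b\<close> would give a second incident point. So it is a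
  multiple, which is the first-order condition for the minors to have a double zero at \<open>v\<close>.\<close>
lemma unique_incident_point_tangent:
  assumes "incident v" "\<And>u. incident u \<Longrightarrow> pt u = pt v"
  shows "tangent_at M \<rho>2 (pt v)"
proof -
  from assms(1) obtain a where a: "a \<in> \<rho>1" "a \<noteq> 0" "beta M a v = 0" and v: "v \<in> \<rho>2" "v \<noteq> 0"
    by (auto simp: incident_def)
  obtain b where b: "b \<in> \<rho>1" "b \<notin> pt a" using Gr2_not_in_pt[OF \<rho>1] .
  obtain w where w: "w \<in> \<rho>2" "w \<notin> pt v" using Gr2_not_in_pt[OF \<rho>2] .
  have bv: "beta M b v \<noteq> 0"
    using corank a(2,3) b(2) v(2) unfolding corank_at_most_one_def in_pt by blast
  have "beta M a w \<in> pt (beta M b v)"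
  proof (rule ccontr)
    assume "beta M a w \<notin> pt (beta M b v)"
    then have "perp \<rho>3 = vec.span {beta M b v, beta M a w}"
      using bv v w a b by (intro Gr2_eq_span[OF perp_\<rho>3] beta_in_perp) auto
    then obtain p r where pr: "beta M b w = p *s beta M b v + r *s beta M a w"
      using beta_in_perp[OF b(1) w(1)] in_span_pair by metis
    let ?u = "(- p) *s v + 1 *s w" and ?c = "(- r) *s a + 1 *s b"
    have "beta M ?c ?u = 0"
      by (simp add: beta_simps a pr vec_eq_iff algebra_simps)
    moreover have "?c \<noteq> 0" "?u \<noteq> 0"
      using independent_pairD[OF a(2) b(2), of "- r" 1] independent_pairD[OF v(2) w(2), of "- p" 1] by auto
    moreover have "?c \<in> \<rho>1" "?u \<in> \<rho>2"
      using a b v w subspace by (simp_all only: vec.subspace_add vec.subspace_scale)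
    ultimately have "pt ?u = pt v" by (intro assms(2)) (unfold incident_def, blast)
    then obtain c where "?u = c *s v" using self_in_pt in_pt by metis
    then have "w = (c + p) *s v" by (simp add: vec_eq_iff algebra_simps)
    then show False using w(2) in_pt by blast
  qed
  then obtain l where l: "beta M a w = l *s beta M b v" by (auto simp: in_pt)
  have "x \<in> tangent_space M (pt v)" if "x \<in> \<rho>2" for x
    unfolding tangent_space_def
  proof (intro CollectI ballI allI impI)
    fix v' c assume v': "v' \<in> pt v - {0}"
    then obtain k where k: "v' = k *s v" "k \<noteq> 0" by (auto simp: in_pt)
    obtain s t where x: "x = s *s v + t *s w"
      using \<open>x \<in> \<rho>2\<close> unfolding Gr2_eq_span[OF \<rho>2 v(1) w(1) v(2) w(2)] in_span_pair by blast
    show "((\<lambda>t::complex. max_minor M c (v' + t *s x)) has_field_derivative 0) (at 0)"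
    proof (rule singular_pencil_double_root[where a=a and b="(- t * l / k) *s b"])
      show "beta M a v' = 0" by (simp add: k beta_simps a)
      show "beta M a x + beta M ((- t * l / k) *s b) v' = 0"
        unfolding k(1) x beta_simps a(3) l using k(2) by (simp add: vec_eq_iff)
    qed (rule a)
  qed
  then show ?thesis
    unfolding tangent_at_def
    using incident_in_S[OF assms(1)] pt_in_proj_sub[OF subspace(2)] v by blast
qed

text \<open>If a single \<open>a\<close> is annihilated over the whole line, \<open>\<psi>\<close> is constant. Otherwise take incident points
  \<open>v, w\<close> with independent kernel vectors \<open>a, b\<close>. Incidence of \<open>v + w\<close> gives a relation
  \<open>x M\<^sub>w\<^sup>t a + y M\<^sub>v\<^sup>t b = 0\<close> with \<open>x, y \<noteq> 0\<close>, and by bilinearity it turns \<open>x z a + y t b\<close> into the kernel vector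
  over \<open>z v + t w\<close>. So \<open>\<psi>\<close> is a linear isomorphism of lines.\<close>
lemma all_incident:
  assumes "\<And>u. u \<in> \<rho>2 \<Longrightarrow> u \<noteq> 0 \<Longrightarrow> incident u"
  shows "proj_sub \<rho>2 \<subseteq> S M"
    "(\<exists>x\<in>proj_sub \<rho>1. psi M ` proj_sub \<rho>2 = {x}) \<or> proj_sub \<rho>1 = psi M ` proj_sub \<rho>2"
proof -
  have proj_subE: "\<exists>v. v \<noteq> 0 \<and> v \<in> \<rho> \<and> L = pt v" if "L \<in> proj_sub \<rho>" "vec.subspace \<rho>"
    for L and \<rho> :: "(complex^'k::finite) set"
    using that pt_in_proj_sub proj_spaceE unfolding proj_sub_def by (metis (mono_tags, lifting) mem_Collect_eq)
  show "proj_sub \<rho>2 \<subseteq> S M"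
    using proj_subE[OF _ subspace(2)] assms incident_in_S by blast
  obtain v where v: "v \<in> \<rho>2" "v \<noteq> 0" using Gr2_basis[OF \<rho>2] by blast
  obtain a where a: "a \<in> \<rho>1" "a \<noteq> 0" "beta M a v = 0" using assms[OF v] by (auto simp: incident_def)
  show "(\<exists>x\<in>proj_sub \<rho>1. psi M ` proj_sub \<rho>2 = {x}) \<or> proj_sub \<rho>1 = psi M ` proj_sub \<rho>2"
  proof (cases "\<forall>u\<in>\<rho>2. beta M a u = 0")
    case True
    then have "psi M (pt u) = pt a" if "u \<in> \<rho>2" "u \<noteq> 0" for u
      using psi_eq[OF corank that(2) a(2)] that by blast
    then have "psi M ` proj_sub \<rho>2 \<subseteq> {pt a}"
      using proj_subE[OF _ subspace(2)] by blast
    moreover have "pt v \<in> proj_sub \<rho>2" "pt a \<in> proj_sub \<rho>1"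
      using pt_in_proj_sub subspace v a by blast+
    ultimately show ?thesis by blast
  next
    case False
    then obtain w where w: "w \<in> \<rho>2" "beta M a w \<noteq> 0" by blast
    then have "w \<noteq> 0" by auto
    then obtain b where b: "b \<in> \<rho>1" "b \<noteq> 0" "beta M b w = 0"
      using assms[OF w(1)] by (auto simp: incident_def)
    have wv: "w \<notin> pt v" using w a by (auto simp: in_pt beta_simps)
    have ba: "b \<notin> pt a" using w b by (auto simp: in_pt beta_simps)
    have bv: "beta M b v \<noteq> 0"
      using corank a(2,3) ba v(2) unfolding corank_at_most_one_def in_pt by blast
    have "v + w \<noteq> 0" using independent_pairD[OF v(2) wv, of 1 1] by auto
    then have "incident (v + w)" using v w subspace by (intro assms vec.subspace_add)
    then obtain c where c: "c \<in> \<rho>1" "c \<noteq> 0" "beta M c (v + w) = 0" by (auto simp: incident_def)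
    have \<rho>1_span: "\<rho>1 = vec.span {a, b}" using Gr2_eq_span[OF \<rho>1 a(1) b(1) a(2) ba] .
    have \<rho>2_span: "\<rho>2 = vec.span {v, w}" using Gr2_eq_span[OF \<rho>2 v(1) w(1) v(2) wv] .
    obtain x y where cxy: "c = x *s a + y *s b" using c(1) unfolding \<rho>1_span in_span_pair by blast
    have rel: "x *s beta M a w + y *s beta M b v = 0"
      using c(3) by (simp add: cxy beta_simps a b add.commute)
    have "x \<noteq> 0" "y \<noteq> 0" using rel c(2) cxy w(2) bv by auto
    have psi_line: "psi M (pt (z *s v + t *s w)) = pt ((x * z) *s a + (y * t) *s b)"
      if "z \<noteq> 0 \<or> t \<noteq> 0" for z t
    proof (rule psi_eq[OF corank])
      show "z *s v + t *s w \<noteq> 0" using that independent_pairD[OF v(2) wv] by blast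
      show "(x * z) *s a + (y * t) *s b \<noteq> 0"
        using that independent_pairD[OF a(2) ba, of "x * z" "y * t"] \<open>x \<noteq> 0\<close> \<open>y \<noteq> 0\<close> by auto
      have "beta M ((x * z) *s a + (y * t) *s b) (z *s v + t *s w)
          = (z * t) *s (x *s beta M a w + y *s beta M b v)"
        by (simp add: beta_simps a b vec_eq_iff algebra_simps)
      then show "beta M ((x * z) *s a + (y * t) *s b) (z *s v + t *s w) = 0" using rel by simp
    qed
    have "psi M ` proj_sub \<rho>2 \<subseteq> proj_sub \<rho>1"
    proof clarify
      fix L assume "L \<in> proj_sub \<rho>2"
      then obtain u where u: "u \<noteq> 0" "u \<in> \<rho>2" "L = pt u" using proj_subE[OF _ subspace(2)] by blast
      then show "psi M L \<in> proj_sub \<rho>1"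
        using incident_alpha[OF assms[OF u(2,1)]] pt_in_proj_sub[OF subspace(1)] by (simp add: psi_def)
    qed
    moreover have "proj_sub \<rho>1 \<subseteq> psi M ` proj_sub \<rho>2"
    proof
      fix L assume "L \<in> proj_sub \<rho>1"
      then obtain d where d: "d \<noteq> 0" "d \<in> \<rho>1" "L = pt d" using proj_subE[OF _ subspace(1)] by blast
      then obtain p q where pq: "d = p *s a + q *s b" unfolding \<rho>1_span in_span_pair by blast
      then have nz: "p / x \<noteq> 0 \<or> q / y \<noteq> 0" using d(1) \<open>x \<noteq> 0\<close> \<open>y \<noteq> 0\<close> by auto
      have "psi M (pt ((p / x) *s v + (q / y) *s w)) = L"
        using psi_line[OF nz] \<open>x \<noteq> 0\<close> \<open>y \<noteq> 0\<close> d(3) pq by simp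
      moreover have "(p / x) *s v + (q / y) *s w \<noteq> 0" using nz independent_pairD[OF v(2) wv] by blast
      moreover have "(p / x) *s v + (q / y) *s w \<in> \<rho>2"
        using v w subspace by (simp add: vec.subspace_add vec.subspace_scale)
      ultimately show "L \<in> psi M ` proj_sub \<rho>2" using pt_in_proj_sub[OF subspace(2)] by blast
    qed
    ultimately show ?thesis by blast
  qed
qed

text \<open>In (a) and (c) uniqueness holds because a competing pair, or a competing point of tangency, consists
  of incident points as well.\<close>
theorem classification:
  "(\<exists>!Q. \<exists>v w. Q = {pt v, pt w} \<and> pt v \<noteq> pt w \<and> Q \<subseteq> S M \<inter> proj_sub \<rho>2 \<and>
      vec.dim (pi_sp M v w) = 2 \<and> (\<rho>1, \<rho>2, \<rho>3) = P_pt M v w)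
    \<or> (proj_sub \<rho>2 \<subseteq> S M \<and> (\<exists>x\<in>proj_sub \<rho>1. psi M ` proj_sub \<rho>2 = {x}))
    \<or> (\<exists>!L. L \<in> S M \<and> tangent_at M \<rho>2 L \<and> psi M L \<in> proj_sub \<rho>1)
    \<or> (proj_sub \<rho>2 \<subseteq> S M \<and> proj_sub \<rho>1 = psi M ` proj_sub \<rho>2)"
proof -
  obtain v where v: "incident v" using exists_incident by blast
  consider (all) "\<And>u. u \<in> \<rho>2 \<Longrightarrow> u \<noteq> 0 \<Longrightarrow> incident u"
    | (two) w u where "incident w" "pt v \<noteq> pt w" "u \<in> \<rho>2" "u \<noteq> 0" "\<not> incident u"
    | (one) "\<And>u. incident u \<Longrightarrow> pt u = pt v"
    by metis
  then show ?thesis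
  proof cases
    case all
    note line = all_incident(1)[OF all]
    from all_incident(2)[OF all] show ?thesis
    proof
      assume "\<exists>x\<in>proj_sub \<rho>1. psi M ` proj_sub \<rho>2 = {x}"
      with line show ?thesis by (intro disjI2 disjI1 conjI)
    next
      assume "proj_sub \<rho>1 = psi M ` proj_sub \<rho>2"
      with line show ?thesis by (intro disjI2 conjI)
    qed
  next
    case (two w u)
    note pair = two_incident_points[OF v two]
    let ?prop = "\<lambda>Q v w. Q = {pt v, pt w} \<and> pt v \<noteq> pt w \<and> Q \<subseteq> S M \<inter> proj_sub \<rho>2 \<and>
      vec.dim (pi_sp M v w) = 2 \<and> (\<rho>1, \<rho>2, \<rho>3) = P_pt M v w"
    have "\<exists>!Q. \<exists>v w. ?prop Q v w"
    proof (rule ex1I)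
      have "{pt v, pt w} \<subseteq> S M \<inter> proj_sub \<rho>2"
        using v two(1) incident_in_S pt_in_proj_sub[OF subspace(2)] by (auto simp: incident_def)
      moreover have "(\<rho>1, \<rho>2, \<rho>3) = P_pt M v w"
        unfolding P_pt_def using pair(1,2,4) by simp
      ultimately show "\<exists>v' w'. ?prop {pt v, pt w} v' w'" using pair(3) two(2) by blast
    next
      fix Q assume "\<exists>v' w'. ?prop Q v' w'"
      then obtain v' w' where Q: "Q = {pt v', pt w'}" "pt v' \<noteq> pt w'" "Q \<subseteq> S M \<inter> proj_sub \<rho>2"
        and "\<rho>1 = vec.span {alpha M (pt v'), alpha M (pt w')}"
        by (auto simp: P_pt_def)
      then have "alpha M (pt v') \<in> \<rho>1" "alpha M (pt w') \<in> \<rho>1"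
        by (auto intro: vec.span_base)
      moreover have "v' \<in> \<rho>2" "w' \<in> \<rho>2" "pt v' \<in> S M" "pt w' \<in> S M"
        using Q(1,3) pt_in_proj_sub[OF subspace(2)] by auto
      ultimately have "incident v'" "incident w'" by (auto intro: incidentI)
      then show "Q = {pt v, pt w}" using pair(5) Q(1,2) by blast
    qed
    then show ?thesis by blast
  next
    case one
    have "\<exists>!L. L \<in> S M \<and> tangent_at M \<rho>2 L \<and> psi M L \<in> proj_sub \<rho>1"
    proof (rule ex1I)
      have "psi M (pt v) \<in> proj_sub \<rho>1"
        using incident_alpha[OF v] pt_in_proj_sub[OF subspace(1)] by (simp add: psi_def)
      then show "pt v \<in> S M \<and> tangent_at M \<rho>2 (pt v) \<and> psi M (pt v) \<in> proj_sub \<rho>1"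
        using unique_incident_point_tangent[OF v one] incident_in_S[OF v] by blast
    next
      fix L assume L: "L \<in> S M \<and> tangent_at M \<rho>2 L \<and> psi M L \<in> proj_sub \<rho>1"
      then have "L \<in> proj_space" by (simp add: S_def)
      then obtain u where u: "L = pt u" by (rule proj_spaceE)
      have "u \<in> \<rho>2" "alpha M (pt u) \<in> \<rho>1"
        using L pt_in_proj_sub subspace unfolding u tangent_at_def psi_def by blast+
      then have "incident u" using L u by (intro incidentI) auto
      then show "L = pt v" using one u by blast
    qed
    then show ?thesis by blast
  qed
qed

end

theorem theorem4p7:
  fixes m s :: nat
  assumes "CARD('n::finite) \<ge> 3"
    and "CARD('p::finite) = CARD('n) + m"
    and "CARD('r::finite) = s + 1"
    and "s \<in> {m + 2..2 * m + 3}"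
  shows "\<exists>U :: ('r, 'p, 'n) linmat set. zariski_open U \<and> U \<noteq> {} \<and>
    (\<forall>M\<in>U. \<forall>\<rho>1 \<rho>2 \<rho>3. (\<rho>1, \<rho>2, \<rho>3) \<in> Z M \<longrightarrow>
      (\<exists>!Q. \<exists>v w. Q = {pt v, pt w} \<and> pt v \<noteq> pt w \<and> Q \<subseteq> S M \<inter> proj_sub \<rho>2 \<and>
          vec.dim (pi_sp M v w) = 2 \<and> (\<rho>1, \<rho>2, \<rho>3) = P_pt M v w)
      \<or> (proj_sub \<rho>2 \<subseteq> S M \<and> (\<exists>x\<in>proj_sub \<rho>1. psi M ` proj_sub \<rho>2 = {x}))
      \<or> (\<exists>!L. L \<in> S M \<and> tangent_at M \<rho>2 L \<and> psi M L \<in> proj_sub \<rho>1)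
      \<or> (proj_sub \<rho>2 \<subseteq> S M \<and> proj_sub \<rho>1 = psi M ` proj_sub \<rho>2))"
proof -
  obtain U :: "('r, 'p, 'n) linmat set" where U: "zariski_open U" "U \<noteq> {}"
    and corank: "\<And>M. M \<in> U \<Longrightarrow> corank_at_most_one M"
    using general_corank_at_most_one[where 'n='n and 'p='p and 'r='r, of m s] assms by auto
  have "zero_of_section M \<rho>1 \<rho>2 \<rho>3" if "M \<in> U" "(\<rho>1, \<rho>2, \<rho>3) \<in> Z M" for M \<rho>1 \<rho>2 \<rho>3
    using corank[OF that(1)] that(2) assms(1,2) by unfold_locales auto
  from zero_of_section.classification[OF this] U show ?thesis
    by (intro exI[of _ U] conjI ballI allI impI)
qed

end
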